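(* For each $\varepsilon\in\{+,0,-\}$, the map $\Theta_\varepsilon=(\psi_3,\Psi_3)$ induced on the moduli space $\mathfrak{Z}_\varepsilon=\mathcal{Z}_\varepsilon/\operatorname{GL}(2,\mathbb{R})$ is a 1-1 map from $\mathfrak{Z}_\varepsilon$ onto a closed simply connected subset of $\mathbb{R}^2$.
   Context: A point $\Gamma=(\Gamma_{11}{}^1,\Gamma_{11}{}^2,\Gamma_{12}{}^1=\Gamma_{21}{}^1,\Gamma_{12}{}^2=\Gamma_{21}{}^2,\Gamma_{22}{}^1,\Gamma_{22}{}^2)\in\mathbb{R}^6$ is regarded as the constant Christoffel symbols of a torsion-free connection $\nabla_{\partial_{x^i}}\partial_{x^j}=\Gamma_{ij}{}^k\partial_{x^k}$ on $\mathbb{R}^2$ (a Type $\mathcal{A}$ structure); repeated indices are summed. Its Ricci tensor $\rho=\rho_\Gamma$ is the constant symmetric bilinear form $$\rho_{11}=\Gamma_{12}{}^2(\Gamma_{11}{}^1-\Gamma_{12}{}^2)+\Gamma_{11}{}^2(\Gamma_{22}{}^2-\Gamma_{12}{}^1),\quad \rho_{12}=\rho_{21}=\Gamma_{12}{}^1\Gamma_{12}{}^2-\Gamma_{11}{}^2\Gamma_{22}{}^1,$$ $$\rho_{22}=\Gamma_{22}{}^1(\Gamma_{11}{}^1-\Gamma_{12}{}^2)+\Gamma_{12}{}^1(\Gamma_{22}{}^2-\Gamma_{12}{}^1).$$ $\mathcal{Z}_+$ (resp. $\mathcal{Z}_0$, $\mathcal{Z}_-$) is the set of $\Gamma\in\mathbb{R}^6$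 for which $\rho_\Gamma$ is positive definite (resp. indefinite, i.e. non-degenerate of signature $(1,1)$; resp. negative definite). The group $\operatorname{GL}(2,\mathbb{R})$ acts on $\mathbb{R}^6$ by linear changes of coordinates: if $T=(a_i^j)$ has inverse matrix $(\tilde a_i^j)$, then $(T^*\Gamma)_{ij}{}^k=\tilde a_i^\alpha\tilde a_j^\beta a^k_\gamma\Gamma_{\alpha\beta}{}^\gamma$. This action preserves each $\mathcal{Z}_\varepsilon$, and the moduli space of isomorphism classes of the corresponding affine structures is $\mathfrak{Z}_\varepsilon=\mathcal{Z}_\varepsilon/\operatorname{GL}(2,\mathbb{R})$. For $\Gamma\in\mathcal{Z}_\varepsilon$, with $(\rho^{ij})$ the inverse matrix of $(\rho_{ij})$, set $$\rho^3_{ij}:=\Gamma_{ik}{}^l\Gamma_{jl}{}^k,\quad \psi_3:=\rho^{ij}\rho^3_{ij},\quad \Psi_3:=\det(\rho^3)/\det(\rho).$$ These are invariant under $\operatorname{GL}(2,\mathbb{R})$, so $\Theta_\varepsilon:=(\psi_3,\Psi_3):\mathcal{Z}_\varepsilon\to\mathbb{R}^2$ descends to a map $\mathfrak{Z}_\varepsilon\to\mathbb{R}^2$, also denoted $\Theta_\varepsilon$. *)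

theory Defs
  imports "HOL-Analysis.Analysis"
begin

text \<open>A point of the parameter space is an array with \<open>G $ i $ j $ k\<close> the Christoffel symbol
  with lower indices \<open>i\<close>, \<open>j\<close> and upper index \<open>k\<close>. The arrays symmetric in \<open>i\<close>, \<open>j\<close> form the
  six-dimensional space of torsion-free constant connections on the plane.\<close>

definition christoffel :: "(real^2^2^2) set" where
  "christoffel = {G. \<forall>i j. G $ i $ j = G $ j $ i}"

definition ricci :: "real^2^2^2 \<Rightarrow> real^2^2" where
  "ricci G =
    (let r11 = G$1$2$2 * (G$1$1$1 - G$1$2$2) + G$1$1$2 * (G$2$2$2 - G$1$2$1);
         r12 = G$1$2$1 * G$1$2$2 - G$1$1$2 * G$2$2$1;
         r22 = G$2$2$1 * (G$1$1$1 - G$1$2$2) + G$1$2$1 * (G$2$2$2 - G$1$2$1)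
     in vector [vector [r11, r12], vector [r12, r22]])"

datatype definiteness = Positive | Indefinite | Negative

text \<open>On a two-dimensional space, a non-degenerate form taking values of both signs is one of
  signature \<open>(1,1)\<close>.\<close>

fun has_definiteness :: "definiteness \<Rightarrow> real^2^2 \<Rightarrow> bool" where
  "has_definiteness Positive A \<longleftrightarrow> (\<forall>x. x \<noteq> 0 \<longrightarrow> x \<bullet> (A *v x) > 0)"
| "has_definiteness Negative A \<longleftrightarrow> (\<forall>x. x \<noteq> 0 \<longrightarrow> x \<bullet> (A *v x) < 0)"
| "has_definiteness Indefinite A \<longleftrightarrow>
     (\<forall>x. (\<forall>y. x \<bullet> (A *v y) = 0) \<longrightarrow> x = 0) \<and>
     (\<exists>x. x \<bullet> (A *v x) > 0) \<and> (\<exists>x. x \<bullet> (A *v x) < 0)"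

definition Z :: "definiteness \<Rightarrow> (real^2^2^2) set" where
  "Z \<epsilon> = {G \<in> christoffel. has_definiteness \<epsilon> (ricci G)}"

text \<open>The lower index of \<open>T\<close> is the row index. With this convention
  \<open>pullback S (pullback T G) = pullback (T ** S) G\<close>.\<close>

definition pullback :: "real^2^2 \<Rightarrow> real^2^2^2 \<Rightarrow> real^2^2^2" where
  "pullback T G = (\<chi> i j k. \<Sum>\<alpha>\<in>UNIV. \<Sum>\<beta>\<in>UNIV. \<Sum>\<gamma>\<in>UNIV.
     matrix_inv T $ i $ \<alpha> * matrix_inv T $ j $ \<beta> * T $ \<gamma> $ k * G $ \<alpha> $ \<beta> $ \<gamma>)"

definition gl_rel :: "definiteness \<Rightarrow> (real^2^2^2) rel" where
  "gl_rel \<epsilon> = {(G, H). G \<in> Z \<epsilon> \<and> H \<in> Z \<epsilon> \<and> (\<exists>T. invertible T \<and> H = pullback T G)}"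

definition moduli :: "definiteness \<Rightarrow> (real^2^2^2) set set" where
  "moduli \<epsilon> = Z \<epsilon> // gl_rel \<epsilon>"

definition rho3 :: "real^2^2^2 \<Rightarrow> real^2^2" where
  "rho3 G = (\<chi> i j. \<Sum>k\<in>UNIV. \<Sum>l\<in>UNIV. G $ i $ k $ l * G $ j $ l $ k)"

definition psi3 :: "real^2^2^2 \<Rightarrow> real" where
  "psi3 G = (\<Sum>i\<in>UNIV. \<Sum>j\<in>UNIV. matrix_inv (ricci G) $ i $ j * rho3 G $ i $ j)"

definition Psi3 :: "real^2^2^2 \<Rightarrow> real" where
  "Psi3 G = det (rho3 G) / det (ricci G)"

definition Theta :: "real^2^2^2 \<Rightarrow> real \<times> real" where
  "Theta G = (psi3 G, Psi3 G)"

text \<open>The common value of \<open>Theta\<close> on an orbit; it exists by \<open>Theta_respects\<close> below.\<close>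

definition Theta_moduli :: "(real^2^2^2) set \<Rightarrow> real \<times> real" where
  "Theta_moduli X = the_elem (Theta ` X)"

subsection \<open>The moduli spaces and the induced maps are well defined\<close>

lemma pullback_matrix:
  "pullback T G $ i = (\<Sum>\<alpha>\<in>UNIV. matrix_inv T $ i $ \<alpha> *\<^sub>R (matrix_inv T ** G $ \<alpha> ** T))"
  by (simp add: vec_eq_iff pullback_def matrix_matrix_mult_def sum_2 algebra_simps forall_2)

lemma rho3_trace: "rho3 G $ i $ j = trace (G $ i ** G $ j)"
  by (simp add: rho3_def trace_def matrix_matrix_mult_def)

lemma matrix_inv_mult:
  fixes T :: "real^2^2"
  assumes "invertible T"
  shows "T ** matrix_inv T = mat 1" "matrix_inv T ** T = mat 1"
  using assms unfolding invertible_def matrix_inv_def by (metis (mono_tags, lifting) someI_ex)+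

lemma matrix_inv_eqI:
  fixes S T :: "real^2^2"
  assumes "T ** S = mat 1"
  shows "matrix_inv T = S"
proof -
  have "invertible T" using assms by (auto simp: invertible_right_inverse)
  then have "matrix_inv T ** T = mat 1" by (rule matrix_inv_mult)
  then have "matrix_inv T ** T ** S = S" by (simp add: matrix_mul_lid)
  then show ?thesis by (simp add: matrix_mul_assoc[symmetric] assms matrix_mul_rid)
qed

lemma trace_conj:
  fixes S T A :: "real^2^2"
  assumes "T ** S = mat 1"
  shows "trace (S ** A ** T) = trace A"
  by (metis assms matrix_mul_assoc matrix_mul_rid trace_mul_sym)

lemma trace_conj2:
  fixes S T A :: "real^2^2"
  assumes "T ** S = mat 1"
  shows "trace ((S ** A ** T) ** (S ** B ** T)) = trace (A ** B)"
proof -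
  have "(S ** A ** T) ** (S ** B ** T) = S ** (A ** (T ** S) ** B) ** T"
    by (simp only: matrix_mul_assoc)
  then show ?thesis using trace_conj[OF assms] by (simp add: assms)
qed

lemma rho3_pullback:
  assumes "invertible T"
  shows "rho3 (pullback T G) = matrix_inv T ** rho3 G ** transpose (matrix_inv T)"
proof -
  define S where "S = matrix_inv T"
  have TS: "T ** S = mat 1" using matrix_inv_mult[OF assms] by (simp add: S_def)
  define C where "C = (\<lambda>a. S ** G $ a ** T)"
  have tr: "trace (C a ** C b) = rho3 G $ a $ b" for a b
    by (simp add: C_def trace_conj2[OF TS] rho3_trace)
  have P: "pullback T G $ i = S $ i $ 1 *\<^sub>R C 1 + S $ i $ 2 *\<^sub>R C 2" for i
    by (simp add: pullback_matrix sum_2 S_def C_def)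
  have "rho3 (pullback T G) $ i $ j = (S ** rho3 G ** transpose S) $ i $ j" for i j
  proof -
    have "rho3 (pullback T G) $ i $ j = S$i$1 * S$j$1 * trace (C 1 ** C 1) + S$i$1 * S$j$2 * trace (C 1 ** C 2)
      + S$i$2 * S$j$1 * trace (C 2 ** C 1) + S$i$2 * S$j$2 * trace (C 2 ** C 2)"
      unfolding rho3_trace P by (simp add: trace_def matrix_matrix_mult_def sum_2 algebra_simps)
    also have "\<dots> = (S ** rho3 G ** transpose S) $ i $ j"
      unfolding tr by (simp add: matrix_matrix_mult_def transpose_def sum_2 algebra_simps)
    finally show ?thesis .
  qed
  then show ?thesis by (simp add: vec_eq_iff S_def)
qed

lemma pullback_christoffel: "G \<in> christoffel \<Longrightarrow> pullback T G \<in> christoffel"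
  by (auto simp: christoffel_def pullback_def vec_eq_iff sum_2 algebra_simps)

lemma ricci_contraction:
  assumes "G \<in> christoffel"
  shows "ricci G $ i $ j = (\<Sum>k\<in>UNIV. G $ i $ j $ k * trace (G $ k)) - rho3 G $ i $ j"
proof -
  have s: "G $ 2 $ 1 = G $ 1 $ 2" using assms by (simp add: christoffel_def)
  have "\<forall>i j. ricci G $ i $ j = (\<Sum>k\<in>UNIV. G $ i $ j $ k * trace (G $ k)) - rho3 G $ i $ j"
    by (simp add: forall_2 ricci_def Let_def rho3_def trace_def sum_2 s vector_2 algebra_simps)
  then show ?thesis by blast
qed

lemma ricci_pullback:
  assumes G: "G \<in> christoffel" and T: "invertible T"
  shows "ricci (pullback T G) = matrix_inv T ** ricci G ** transpose (matrix_inv T)"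
proof -
  define S where "S = matrix_inv T"
  have TS: "T ** S = mat 1" using matrix_inv_mult[OF T] by (simp add: S_def)
  have t: "trace (pullback T G $ k) = S $ k $ 1 * trace (G $ 1) + S $ k $ 2 * trace (G $ 2)" for k
  proof -
    have "trace (pullback T G $ k) = S $ k $ 1 * trace (S ** G $ 1 ** T) + S $ k $ 2 * trace (S ** G $ 2 ** T)"
      unfolding pullback_matrix S_def[symmetric] by (simp add: trace_def sum_2 algebra_simps)
    then show ?thesis by (simp add: trace_conj[OF TS])
  qed
  have e: "(T ** S) $ a $ b = (mat 1 :: real^2^2) $ a $ b" for a b by (simp add: TS)
  have e': "T$a$1 * S$1$b + T$a$2 * S$2$b = (if a = b then 1 else 0)" for a b
    using e[of a b] by (simp add: matrix_matrix_mult_def sum_2 mat_def)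
  have c: "(\<Sum>k\<in>UNIV. pullback T G $ i $ j $ k * trace (pullback T G $ k)) =
     (\<Sum>\<alpha>\<in>UNIV. \<Sum>\<beta>\<in>UNIV. S$i$\<alpha> * S$j$\<beta> * (\<Sum>k\<in>UNIV. G$\<alpha>$\<beta>$k * trace (G $ k)))" for i j
  proof -
    define W where "W = (\<lambda>\<gamma>. \<Sum>\<alpha>\<in>UNIV. \<Sum>\<beta>\<in>UNIV. S$i$\<alpha> * S$j$\<beta> * G$\<alpha>$\<beta>$\<gamma>)"
    have P: "pullback T G $ i $ j $ k = W 1 * T$1$k + W 2 * T$2$k" for k
      by (simp add: pullback_def S_def[symmetric] W_def sum_2 distrib_left distrib_right mult.commute mult.left_commute)
    have "(\<Sum>k\<in>UNIV. pullback T G $ i $ j $ k * trace (pullback T G $ k)) =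
      W 1 * ((T$1$1 * S$1$1 + T$1$2 * S$2$1) * trace (G$1) + (T$1$1 * S$1$2 + T$1$2 * S$2$2) * trace (G$2)) +
      W 2 * ((T$2$1 * S$1$1 + T$2$2 * S$2$1) * trace (G$1) + (T$2$1 * S$1$2 + T$2$2 * S$2$2) * trace (G$2))"
      unfolding P t sum_2 by algebra
    also have "\<dots> = W 1 * trace (G$1) + W 2 * trace (G$2)"
      unfolding e' by simp
    also have "\<dots> = (\<Sum>\<alpha>\<in>UNIV. \<Sum>\<beta>\<in>UNIV. S$i$\<alpha> * S$j$\<beta> * (\<Sum>k\<in>UNIV. G$\<alpha>$\<beta>$k * trace (G $ k)))"
      unfolding W_def sum_2 by algebra
    finally show ?thesis .
  qed
  have r: "rho3 (pullback T G) = S ** rho3 G ** transpose S"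
    using rho3_pullback[OF T] by (simp add: S_def)
  have "ricci (pullback T G) $ i $ j = (S ** ricci G ** transpose S) $ i $ j" for i j
    unfolding ricci_contraction[OF pullback_christoffel[OF G]] c r
    by (simp add: matrix_matrix_mult_def transpose_def sum_2 ricci_contraction[OF G] algebra_simps)
  then show ?thesis by (simp add: vec_eq_iff S_def)
qed

lemma pullback_id: "pullback (mat 1) G = G"
proof -
  have "matrix_inv (mat 1 :: real^2^2) = mat 1"
    by (intro matrix_inv_eqI) (simp add: matrix_mul_lid)
  then have "pullback (mat 1) G $ i = (\<Sum>\<alpha>\<in>UNIV. (mat 1 :: real^2^2) $ i $ \<alpha> *\<^sub>R G $ \<alpha>)" for i
    by (simp add: pullback_matrix matrix_mul_lid matrix_mul_rid)
  then have "\<forall>i. pullback (mat 1) G $ i = G $ i"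
    by (simp add: forall_2 sum_2 mat_def)
  then show ?thesis by (simp add: vec_eq_iff)
qed

lemma matrix_inv_mul:
  fixes S T :: "real^2^2"
  assumes "invertible S" "invertible T"
  shows "matrix_inv (T ** S) = matrix_inv S ** matrix_inv T"
proof -
  have "(T ** S) ** (matrix_inv S ** matrix_inv T) = T ** (S ** matrix_inv S) ** matrix_inv T"
    by (simp only: matrix_mul_assoc)
  then have "(T ** S) ** (matrix_inv S ** matrix_inv T) = mat 1"
    using assms by (simp add: matrix_inv_mult)
  then show ?thesis by (rule matrix_inv_eqI)
qed

lemma pullback_comp:
  assumes "invertible S" "invertible T"
  shows "pullback S (pullback T G) = pullback (T ** S) G"
proof -
  define X where "X = matrix_inv S"
  define Y where "Y = matrix_inv T"
  have XY: "matrix_inv (T ** S) = X ** Y" using matrix_inv_mul[OF assms] by (simp add: X_def Y_def)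
  have lin: "X ** (a *\<^sub>R A + b *\<^sub>R B) ** S = a *\<^sub>R (X ** A ** S) + b *\<^sub>R (X ** B ** S)"
    for a b and A B :: "real^2^2"
    by (simp add: vec_eq_iff matrix_matrix_mult_def sum_2 algebra_simps)
  define D where "D = (\<lambda>b. X ** (Y ** G $ b ** T) ** S)"
  have D: "X ** Y ** G $ b ** (T ** S) = D b" for b
    by (simp add: D_def matrix_mul_assoc)
  have "pullback S (pullback T G) $ i = pullback (T ** S) G $ i" for i
  proof -
    have "X ** (pullback T G $ a) ** S = Y $ a $ 1 *\<^sub>R D 1 + Y $ a $ 2 *\<^sub>R D 2" for a
      unfolding pullback_matrix[of T] Y_def[symmetric] sum_2 lin D_def ..
    then have "pullback S (pullback T G) $ i =
        X $ i $ 1 *\<^sub>R (Y $ 1 $ 1 *\<^sub>R D 1 + Y $ 1 $ 2 *\<^sub>R D 2) + X $ i $ 2 *\<^sub>R (Y $ 2 $ 1 *\<^sub>R D 1 + Y $ 2 $ 2 *\<^sub>R D 2)"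
      unfolding pullback_matrix[of S] X_def[symmetric] sum_2 by simp
    also have "\<dots> = (X ** Y) $ i $ 1 *\<^sub>R D 1 + (X ** Y) $ i $ 2 *\<^sub>R D 2"
      by (simp add: matrix_matrix_mult_def sum_2 algebra_simps)
    also have "\<dots> = pullback (T ** S) G $ i"
      unfolding pullback_matrix[of "T ** S"] XY sum_2 D ..
    finally show ?thesis .
  qed
  then show ?thesis by (simp add: vec_eq_iff)
qed

lemma invertible_transpose: "invertible T \<Longrightarrow> invertible (transpose T)" for T :: "real^2^2"
  by (simp add: invertible_det_nz)

lemma invertible_matrix_inv: "invertible T \<Longrightarrow> invertible (matrix_inv T)" for T :: "real^2^2"
  unfolding invertible_def[of "matrix_inv T"] using matrix_inv_mult[of T] by blast

lemma quad_congruence: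
  fixes S A :: "real^2^2"
  shows "x \<bullet> ((S ** A ** transpose S) *v y) = (transpose S *v x) \<bullet> (A *v (transpose S *v y))"
proof -
  have "(S ** A ** transpose S) *v y = S *v (A *v (transpose S *v y))"
    by (simp only: matrix_vector_mul_assoc matrix_mul_assoc)
  then show ?thesis
    by (simp only: dot_lmul_matrix transpose_matrix_vector)
qed

lemma has_definiteness_congruence:
  fixes S A :: "real^2^2"
  assumes S: "invertible S" and A: "has_definiteness \<epsilon> A"
  shows "has_definiteness \<epsilon> (S ** A ** transpose S)"
proof -
  define R where "R = transpose S"
  have R: "invertible R" using S by (simp add: R_def invertible_transpose)
  have q: "x \<bullet> ((S ** A ** transpose S) *v y) = (R *v x) \<bullet> (A *v (R *v y))" for x y
    by (simp add: quad_congruence R_def)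
  have nz: "R *v x = 0 \<longleftrightarrow> x = 0" for x
    by (metis R matrix_inv_mult(2) matrix_vector_mul_assoc matrix_vector_mul_lid matrix_vector_mult_0_right)
  have sj: "\<exists>x. R *v x = y" for y
    by (metis R matrix_inv_mult(1) matrix_vector_mul_assoc matrix_vector_mul_lid)
  show ?thesis
  proof (cases \<epsilon>)
    case Indefinite
    have "x = 0" if "\<forall>y. (R *v x) \<bullet> (A *v (R *v y)) = 0" for x
      using that A sj nz Indefinite by (metis has_definiteness.simps(3))
    moreover have "(\<exists>x. (R *v x) \<bullet> (A *v (R *v x)) > 0) \<and> (\<exists>x. (R *v x) \<bullet> (A *v (R *v x)) < 0)"
      using A sj Indefinite by (metis has_definiteness.simps(3))
    ultimately show ?thesis by (simp add: Indefinite q)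
  qed (use A nz in \<open>auto simp: q\<close>)
qed

lemma pullback_Z: "G \<in> Z \<epsilon> \<Longrightarrow> invertible T \<Longrightarrow> pullback T G \<in> Z \<epsilon>"
  by (simp add: Z_def pullback_christoffel ricci_pullback has_definiteness_congruence invertible_matrix_inv)

lemma equiv_gl_rel: "equiv (Z \<epsilon>) (gl_rel \<epsilon>)"
proof (rule equivI)
  show "gl_rel \<epsilon> \<subseteq> Z \<epsilon> \<times> Z \<epsilon>" by (auto simp: gl_rel_def)
  have "invertible (mat 1 :: real^2^2)" by (auto simp: invertible_def matrix_mul_lid)
  then show "refl_on (Z \<epsilon>) (gl_rel \<epsilon>)"
    by (auto simp: refl_on_def gl_rel_def intro!: exI[of _ "mat 1"] simp: pullback_id)
  show "sym (gl_rel \<epsilon>)"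
  proof (rule symI)
    fix G H assume "(G, H) \<in> gl_rel \<epsilon>"
    then obtain T where T: "G \<in> Z \<epsilon>" "H \<in> Z \<epsilon>" "invertible T" "H = pullback T G"
      by (auto simp: gl_rel_def)
    then have "pullback (matrix_inv T) H = G"
      by (simp add: pullback_comp invertible_matrix_inv matrix_inv_mult pullback_id)
    with T show "(H, G) \<in> gl_rel \<epsilon>"
      unfolding gl_rel_def by (auto intro!: exI[of _ "matrix_inv T"] invertible_matrix_inv)
  qed
  show "trans (gl_rel \<epsilon>)"
    by (rule transI) (auto simp: gl_rel_def pullback_comp intro: invertible_mult)
qed

lemma has_definiteness_det:
  fixes A :: "real^2^2"
  assumes "has_definiteness \<epsilon> A"
  shows "invertible A"
proof -
  have "A *v x = 0 \<Longrightarrow> x = 0" if "\<epsilon> \<noteq> Indefinite" for x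
    using assms that by (cases \<epsilon>) force+
  then have "invertible A" if "\<epsilon> \<noteq> Indefinite"
    using that by (simp add: invertible_left_inverse matrix_left_invertible_ker)
  moreover have "invertible (transpose A)" if "\<epsilon> = Indefinite"
  proof -
    have "x = 0" if "transpose A *v x = 0" for x
    proof -
      have "x \<bullet> (A *v y) = 0" for y
        using that by (simp only: dot_lmul_matrix[symmetric] transpose_matrix_vector inner_zero_left)
      then show ?thesis using assms \<open>\<epsilon> = Indefinite\<close> by simp
    qed
    then show ?thesis by (simp add: invertible_left_inverse matrix_left_invertible_ker)
  qed
  ultimately show ?thesis
    by (metis invertible_transpose transpose_transpose)
qed

lemma Theta_pullback:
  assumes G: "G \<in> Z \<epsilon>" and T: "invertible T"
  shows "Theta (pullback T G) = Theta G"
proof -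
  define S where "S = matrix_inv T"
  define A where "A = ricci G"
  define B where "B = rho3 G"
  have TS: "T ** S = mat 1" "S ** T = mat 1" and S: "invertible S"
    using T by (simp_all add: S_def matrix_inv_mult invertible_matrix_inv)
  have A: "invertible A" using G by (auto simp: Z_def A_def intro: has_definiteness_det)
  have r: "ricci (pullback T G) = S ** A ** transpose S" "rho3 (pullback T G) = S ** B ** transpose S"
    using G T by (simp_all add: Z_def S_def A_def B_def ricci_pullback rho3_pullback)
  have d: "det S \<noteq> 0" using S by (simp add: invertible_det_nz)
  have Psi: "Psi3 (pullback T G) = Psi3 G"
    using d by (simp add: Psi3_def r det_mul A_def B_def)
  have tt: "transpose S ** transpose T = mat 1"
    by (metis TS(1) matrix_transpose_mul transpose_mat)
  have inv: "matrix_inv (S ** A ** transpose S) = transpose T ** matrix_inv A ** T"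
  proof -
    have "matrix_inv (transpose S) = transpose T"
      by (rule matrix_inv_eqI[OF tt])
    moreover have "matrix_inv S = T"
      by (rule matrix_inv_eqI[OF TS(2)])
    ultimately show ?thesis
      using A S by (simp add: matrix_inv_mul invertible_mult invertible_transpose matrix_mul_assoc)
  qed
  have p: "psi3 H = trace (transpose (matrix_inv (ricci H)) ** rho3 H)" for H
    by (simp add: psi3_def trace_def matrix_matrix_mult_def transpose_def sum_2)
  have "transpose (transpose T ** matrix_inv A ** T) ** (S ** B ** transpose S)
     = transpose T ** transpose (matrix_inv A) ** (T ** S) ** B ** transpose S"
    by (simp add: matrix_transpose_mul transpose_transpose matrix_mul_assoc)
  also have "\<dots> = transpose T ** (transpose (matrix_inv A) ** B) ** transpose S"
    by (simp add: TS matrix_mul_assoc)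
  finally have "psi3 (pullback T G) =
      trace (transpose T ** (transpose (matrix_inv A) ** B) ** transpose S)"
    by (simp only: p r inv)
  then have "psi3 (pullback T G) = psi3 G"
    by (simp only: trace_conj[OF tt] p A_def B_def)
  with Psi show ?thesis by (simp add: Theta_def)
qed

lemma Theta_respects: "Theta respects gl_rel \<epsilon>"
  by (auto simp: congruent_def gl_rel_def Theta_pullback)

lemma Theta_moduli_class: "G \<in> Z \<epsilon> \<Longrightarrow> Theta_moduli (gl_rel \<epsilon> `` {G}) = Theta G"
proof -
  assume "G \<in> Z \<epsilon>"
  then have "G \<in> gl_rel \<epsilon> `` {G}" using equiv_gl_rel by (metis equiv_class_self)
  then have "Theta ` (gl_rel \<epsilon> `` {G}) = {Theta G}"
    using Theta_respects by (force simp: congruent_def)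
  then show ?thesis by (simp add: Theta_moduli_def)
qed

end

theory Submission
  imports Defs
begin

text \<open>Bring the Ricci tensor to a constant normal form: off-diagonal with entries \<open>1\<close> if it is
  indefinite, \<open>2 \<sigma>\<close> times the identity with \<open>\<sigma> = 1\<close> or \<open>\<sigma> = - 1\<close> if it is definite. The Ricci
  equations then force the Christoffel symbols, lowered by the Ricci tensor, to be totally symmetric,
  so what remains is a binary cubic form under the one-dimensional orthogonal group. In null
  coordinates it has coefficients \<open>b\<close>, \<open>d\<close>, \<open>c\<close>, \<open>e\<close> of weights \<open>3\<close>, \<open>1\<close>, \<open>- 1\<close>, \<open>- 3\<close> with
  \<open>c d - b e = \<sigma>\<close> (and \<open>\<sigma> = 1\<close> in the indefinite case), and its invariants are \<open>p = c d\<close> and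
  \<open>r = b c\<^sup>3 + e d\<^sup>3\<close>. The product of the two terms of \<open>r\<close> is \<open>(p - \<sigma>) p\<^sup>3\<close>; the terms are real in
  the indefinite case, whence \<open>r\<^sup>2 \<ge> 4 (p - \<sigma>) p\<^sup>3\<close>, and complex conjugate in the definite case, whence
  \<open>r\<^sup>2 \<le> 4 (p - \<sigma>) p\<^sup>3\<close> and \<open>p = \<bar>d\<bar>\<^sup>2 \<ge> 0\<close>, \<open>p - \<sigma> = \<bar>b\<bar>\<^sup>2 \<ge> 0\<close>. These closed regions of the
  \<open>(p, r)\<close>-plane are contractible and parametrise the orbits, and \<open>(\<psi>\<^sub>3, \<Psi>\<^sub>3)\<close> is the image of
  \<open>(p, r)\<close> under a homeomorphism of the plane.\<close>

subsection \<open>Normalising the Ricci tensor\<close>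

definition array :: "real \<Rightarrow> real \<Rightarrow> real \<Rightarrow> real \<Rightarrow> real \<Rightarrow> real \<Rightarrow> real^2^2^2" where
  "array a b c d e f = vector [vector [vector [a, b], vector [c, d]],
                               vector [vector [c, d], vector [e, f]]]"

lemma array_nth [simp]:
  "array a b c d e f $ 1 $ 1 $ 1 = a" "array a b c d e f $ 1 $ 1 $ 2 = b"
  "array a b c d e f $ 1 $ 2 $ 1 = c" "array a b c d e f $ 1 $ 2 $ 2 = d"
  "array a b c d e f $ 2 $ 1 $ 1 = c" "array a b c d e f $ 2 $ 1 $ 2 = d"
  "array a b c d e f $ 2 $ 2 $ 1 = e" "array a b c d e f $ 2 $ 2 $ 2 = f"
  by (simp_all add: array_def vector_2)

lemma array_christoffel: "array a b c d e f \<in> christoffel"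
  by (simp add: christoffel_def forall_2 vec_eq_iff)

lemma christoffel_array:
  assumes "G \<in> christoffel"
  obtains a b c d e f where "G = array a b c d e f"
proof -
  have "G $ 2 $ 1 = G $ 1 $ 2" using assms by (simp add: christoffel_def)
  then have "G = array (G$1$1$1) (G$1$1$2) (G$1$2$1) (G$1$2$2) (G$2$2$1) (G$2$2$2)"
    by (simp add: vec_eq_iff forall_2)
  then show thesis by (rule that)
qed

lemma vector_2_2_eq_iff:
  fixes A :: "real^2^2"
  shows "A = vector [vector [a, b], vector [c, d]] \<longleftrightarrow>
    A$1$1 = a \<and> A$1$2 = b \<and> A$2$1 = c \<and> A$2$2 = d"
  by (auto simp: vec_eq_iff forall_2 vector_2)

lemma ricci_array:
  "ricci (array a b c d e f) = vector
     [vector [d * (a - d) + b * (f - c), c * d - b * e],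
      vector [c * d - b * e, e * (a - d) + c * (f - c)]]"
  by (simp add: ricci_def Let_def)

lemma rho3_array:
  "rho3 (array a b c d e f) = vector
     [vector [a\<^sup>2 + 2 * b * c + d\<^sup>2, a * c + b * e + c * d + d * f],
      vector [a * c + b * e + c * d + d * f, c\<^sup>2 + 2 * d * e + f\<^sup>2]]"
  by (simp add: vector_2_2_eq_iff rho3_def sum_2 power2_eq_square)

text \<open>Unlike \<open>gl_rel\<close>, this asks for no membership in
  \<open>Z \<epsilon>\<close>, so coordinate changes can be chained without checking definiteness at
  the intermediate arrays.\<close>

definition isomorphic :: "real^2^2^2 \<Rightarrow> real^2^2^2 \<Rightarrow> bool" (infix "\<simeq>" 50) where
  "G \<simeq> H \<longleftrightarrow> (\<exists>T. invertible T \<and> H = pullback T G)"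

lemma isomorphic_trans [trans]: "G \<simeq> H \<Longrightarrow> H \<simeq> K \<Longrightarrow> G \<simeq> K"
  by (auto simp: isomorphic_def pullback_comp intro: invertible_mult)

lemma isomorphic_refl: "G \<simeq> G"
  unfolding isomorphic_def
  by (intro exI[of _ "mat 1"]) (auto simp: pullback_id invertible_def)

text \<open>In the frame of the row vectors \<open>(s, t)\<close>, \<open>(u, v)\<close> the Christoffel symbols of \<open>array a b c d e f\<close>
  become \<open>array a' b' c' d' e' f'\<close>. Multiplying by the frame on the right removes its inverse, so
  that the conditions are polynomial.\<close>

lemma isomorphic_array:
  assumes det: "s * v - t * u \<noteq> 0"
    and eqs: "a' * s + b' * u = s\<^sup>2 * a + 2 * s * t * c + t\<^sup>2 * e"
      "a' * t + b' * v = s\<^sup>2 * b + 2 * s * t * d + t\<^sup>2 * f"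
      "c' * s + d' * u = s * u * a + (s * v + t * u) * c + t * v * e"
      "c' * t + d' * v = s * u * b + (s * v + t * u) * d + t * v * f"
      "e' * s + f' * u = u\<^sup>2 * a + 2 * u * v * c + v\<^sup>2 * e"
      "e' * t + f' * v = u\<^sup>2 * b + 2 * u * v * d + v\<^sup>2 * f"
  shows "array a b c d e f \<simeq> array a' b' c' d' e' f'"
proof -
  define G where "G = array a b c d e f"
  define H where "H = array a' b' c' d' e' f'"
  define S :: "real^2^2" where "S = vector [vector [s, t], vector [u, v]]"
  define T where "T = matrix_inv S"
  have S: "invertible S" using det by (simp add: S_def invertible_det_nz det_2 vector_2)
  have T: "invertible T" using S by (simp add: T_def invertible_matrix_inv)
  have ST: "S ** T = mat 1" "T ** S = mat 1" using matrix_inv_mult[OF S] by (simp_all add: T_def)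
  have inv: "matrix_inv T = S" by (rule matrix_inv_eqI[OF ST(2)])
  have HS: "H $ i ** S = S $ i $ 1 *\<^sub>R (S ** G $ 1) + S $ i $ 2 *\<^sub>R (S ** G $ 2)" for i
  proof -
    have "\<forall>i. H $ i ** S = S $ i $ 1 *\<^sub>R (S ** G $ 1) + S $ i $ 2 *\<^sub>R (S ** G $ 2)"
      using eqs by (simp add: forall_2 vec_eq_iff matrix_matrix_mult_def sum_2 S_def G_def H_def
          vector_2 algebra_simps power2_eq_square)
    then show ?thesis by blast
  qed
  have lin: "(x *\<^sub>R A + y *\<^sub>R B) ** T = x *\<^sub>R (A ** T) + y *\<^sub>R (B ** T)"
    for x y and A B :: "real^2^2"
    by (simp add: vec_eq_iff matrix_matrix_mult_def sum_2 algebra_simps)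
  have "H $ i = pullback T G $ i" for i
  proof -
    have "H $ i = H $ i ** S ** T" by (simp add: matrix_mul_assoc[symmetric] ST)
    also have "\<dots> = pullback T G $ i" by (simp only: HS lin pullback_matrix inv sum_2)
    finally show ?thesis .
  qed
  then have "H = pullback T G" by (simp add: vec_eq_iff)
  then show ?thesis using T unfolding isomorphic_def G_def H_def by blast
qed

text \<open>Pulling back along the inverse of the frame matrix \<open>S\<close> replaces the Ricci
  matrix by its congruence under \<open>S\<close>. Normalising the Ricci tensor thus becomes a
  question about binary quadratic forms.\<close>

lemma ricci_congruence:
  assumes G: "G \<in> christoffel" and A: "ricci G = vector [vector [A, B], vector [B, C]]"
    and det: "s * v - t * u \<noteq> 0"
  obtains H where "H \<in> christoffel" "G \<simeq> H"
    "ricci H = vector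
      [vector [A * s\<^sup>2 + 2 * B * s * t + C * t\<^sup>2, A * s * u + B * (s * v + t * u) + C * t * v],
       vector [A * s * u + B * (s * v + t * u) + C * t * v, A * u\<^sup>2 + 2 * B * u * v + C * v\<^sup>2]]"
proof -
  define S :: "real^2^2" where "S = vector [vector [s, t], vector [u, v]]"
  define T where "T = matrix_inv S"
  have S: "invertible S" using det by (simp add: S_def invertible_det_nz det_2 vector_2)
  have T: "invertible T" using S by (simp add: T_def invertible_matrix_inv)
  have inv: "matrix_inv T = S"
    unfolding T_def by (rule matrix_inv_eqI) (simp add: matrix_inv_mult[OF S])
  show thesis
  proof (rule that)
    show "pullback T G \<in> christoffel" by (rule pullback_christoffel[OF G])
    show "G \<simeq> pullback T G" using T by (auto simp: isomorphic_def)
    show "ricci (pullback T G) = vector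
      [vector [A * s\<^sup>2 + 2 * B * s * t + C * t\<^sup>2, A * s * u + B * (s * v + t * u) + C * t * v],
       vector [A * s * u + B * (s * v + t * u) + C * t * v, A * u\<^sup>2 + 2 * B * u * v + C * v\<^sup>2]]"
      unfolding ricci_pullback[OF G T] inv A vector_2_2_eq_iff
      by (simp add: S_def matrix_matrix_mult_def transpose_def sum_2 vector_2 algebra_simps power2_eq_square)
  qed
qed

section \<open>Binary quadratic forms and their normalising frames\<close>

lemma quadratic_form_2:
  fixes x y :: "real^2"
  shows "x \<bullet> (vector [vector [A, B], vector [B, C]] *v y) =
    A * x$1 * y$1 + B * (x$1 * y$2 + x$2 * y$1) + C * x$2 * y$2"
  by (simp add: inner_vec_def sum_2 matrix_vector_mult_def vector_2 algebra_simps)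

text \<open>Completing the square shows that if \<open>B\<^sup>2 \<le> A * C\<close>, then
  \<open>A\<close> times the form is nowhere negative. Since the form takes both signs,
  \<open>A\<close> and then \<open>B\<close> vanish, and the remaining \<open>C * y\<^sup>2\<close>
  has only one sign.\<close>

lemma indefinite_discriminant_pos:
  assumes "has_definiteness Indefinite (vector [vector [A, B], vector [B, C]])"
  shows "B\<^sup>2 - A * C > 0"
proof (rule ccontr)
  assume "\<not> ?thesis"
  then have n: "B\<^sup>2 \<le> A * C" by simp
  define Q where "Q = (\<lambda>x y. A * x\<^sup>2 + 2 * B * x * y + C * y\<^sup>2)"
  obtain x y x' y' where Q: "Q x y > 0" "Q x' y' < 0"
  proof -
    have "Q (x$1) (x$2) = x \<bullet> (vector [vector [A, B], vector [B, C]] *v x)" for x :: "real^2"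
      by (simp add: quadratic_form_2 Q_def algebra_simps power2_eq_square)
    with assms that show thesis by (metis has_definiteness.simps(3))
  qed
  have AQ: "A * Q x y \<ge> 0" for x y
  proof -
    have "A * Q x y = (A * x + B * y)\<^sup>2 + (A * C - B\<^sup>2) * y\<^sup>2"
      unfolding Q_def by algebra
    then show ?thesis using n by simp
  qed
  have "A = 0"
    using AQ[of x y] AQ[of x' y'] Q
    by (metis linorder_neqE_linordered_idom mult_neg_pos mult_pos_neg not_le)
  with n have "B = 0" by simp
  with \<open>A = 0\<close> Q show False
    by (auto simp: Q_def zero_less_mult_iff mult_less_0_iff)
qed

lemma definite_minors_pos:
  assumes "has_definiteness \<epsilon> (vector [vector [A, B], vector [B, C]])"
    and "\<epsilon> = Positive \<and> \<sigma> = 1 \<or> \<epsilon> = Negative \<and> \<sigma> = - 1"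
  shows "\<sigma> * A > 0" "A * C - B\<^sup>2 > 0"
proof -
  have Q: "\<sigma> * (A * x\<^sup>2 + 2 * B * x * y + C * y\<^sup>2) > 0" if "x \<noteq> 0 \<or> y \<noteq> 0" for x y
  proof -
    have "vector [x, y] \<noteq> (0 :: real^2)" using that by (auto simp: vec_eq_iff forall_2 vector_2)
    then show ?thesis using assms
      by (auto simp: quadratic_form_2 vector_2 power2_eq_square algebra_simps dest!: spec[of _ "vector [x, y]"])
  qed
  show 1: "\<sigma> * A > 0" using Q[of 1 0] by simp
  have "A \<noteq> 0" using 1 by auto
  \<comment> \<open>The vector \<open>(- B, A)\<close> is orthogonal to \<open>(1, 0)\<close> with
    respect to the form.\<close>
  then have "\<sigma> * (A * B\<^sup>2 - 2 * B * B * A + C * A\<^sup>2) > 0" using Q[of "- B" A] by simp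
  moreover have "\<sigma> * (A * B\<^sup>2 - 2 * B * B * A + C * A\<^sup>2) = (\<sigma> * A) * (A * C - B\<^sup>2)" by algebra
  ultimately show "A * C - B\<^sup>2 > 0" using 1 by (simp add: zero_less_mult_iff)
qed

lemma Z_ricci_symmetric:
  assumes "G \<in> Z \<epsilon>"
  obtains A B C where "ricci G = vector [vector [A, B], vector [B, C]]"
    "has_definiteness \<epsilon> (vector [vector [A, B], vector [B, C]])"
  using assms that unfolding Z_def ricci_def Let_def by blast

text \<open>Two independent null vectors as a frame kill the diagonal; rescaling one of them makes
  the off-diagonal entry \<open>1\<close>.\<close>

lemma indefinite_ricci_normalized:
  assumes "G \<in> Z Indefinite"
  obtains H where "H \<in> christoffel" "G \<simeq> H" "ricci H = vector [vector [0, 1], vector [1, 0]]"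
proof -
  obtain A B C where r: "ricci G = vector [vector [A, B], vector [B, C]]"
    and "has_definiteness Indefinite (vector [vector [A, B], vector [B, C]])"
    using assms by (rule Z_ricci_symmetric)
  then have D: "B\<^sup>2 - A * C > 0" by (metis indefinite_discriminant_pos)
  have G: "G \<in> christoffel" using assms by (simp add: Z_def)
  have "\<exists>s t u v. s * v - t * u \<noteq> 0 \<and> A * s\<^sup>2 + 2 * B * s * t + C * t\<^sup>2 = 0 \<and>
    A * s * u + B * (s * v + t * u) + C * t * v = 1 \<and> A * u\<^sup>2 + 2 * B * u * v + C * v\<^sup>2 = 0"
  proof (cases "A = 0")
    case True
    with D have "B \<noteq> 0" by auto
    \<comment> \<open>Here \<open>(1, 0)\<close> is already null, and the second vector is solved
      for.\<close>
    show ?thesis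
      by (rule exI[of _ 1], rule exI[of _ 0], rule exI[of _ "- C / (2 * B\<^sup>2)"], rule exI[of _ "1 / B"])
         (use \<open>B \<noteq> 0\<close> in \<open>simp add: True field_simps power2_eq_square\<close>)
  next
    case False
    \<comment> \<open>By the quadratic formula \<open>(w - B, A)\<close> and
      \<open>(- w - B, A)\<close> are null. Their mutual product is
      \<open>- 2 * A * w\<^sup>2\<close>, which \<open>k\<close> scales to \<open>1\<close>.\<close>
    define w where "w = sqrt (B\<^sup>2 - A * C)"
    have w: "w\<^sup>2 = B\<^sup>2 - A * C" "w \<noteq> 0" using D by (simp_all add: w_def)
    define k where "k = - 1 / (2 * A * w\<^sup>2)"
    have k: "k * (2 * A * w\<^sup>2) = - 1" "k \<noteq> 0" using False w(2) by (simp_all add: k_def)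
    show ?thesis
    proof (rule exI[of _ "w - B"], rule exI[of _ A], rule exI[of _ "k * (- w - B)"],
        rule exI[of _ "k * A"], intro conjI)
      have "(w - B) * (k * A) - A * (k * (- w - B)) = 2 * w * (k * A)" by algebra
      then show "(w - B) * (k * A) - A * (k * (- w - B)) \<noteq> 0" using False w k by simp
    qed (use w(1) k(1) in algebra)+
  qed
  then obtain s t u v where "s * v - t * u \<noteq> 0" "A * s\<^sup>2 + 2 * B * s * t + C * t\<^sup>2 = 0"
    "A * s * u + B * (s * v + t * u) + C * t * v = 1" "A * u\<^sup>2 + 2 * B * u * v + C * v\<^sup>2 = 0" by blast
  then show thesis using ricci_congruence[OF G r] that by metis
qed

text \<open>Gram-Schmidt: \<open>(1, 0)\<close> and \<open>(- B, A)\<close> are orthogonal for the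
  form, with values \<open>A\<close> and \<open>A * (A * C - B\<^sup>2)\<close> of sign \<sigma>.
  The factors \<open>k\<close> and \<open>n\<close> rescale both values to
  \<open>2 * \<sigma>\<close>.\<close>

lemma definite_ricci_normalized:
  assumes "G \<in> Z \<epsilon>" and \<sigma>: "\<epsilon> = Positive \<and> \<sigma> = 1 \<or> \<epsilon> = Negative \<and> \<sigma> = - 1"
  obtains H where "H \<in> christoffel" "G \<simeq> H"
    "ricci H = vector [vector [2 * \<sigma>, 0], vector [0, 2 * \<sigma>]]"
proof -
  obtain A B C where r: "ricci G = vector [vector [A, B], vector [B, C]]"
    and "has_definiteness \<epsilon> (vector [vector [A, B], vector [B, C]])"
    using assms(1) by (rule Z_ricci_symmetric)
  then have pos: "\<sigma> * A > 0" "A * C - B\<^sup>2 > 0" using definite_minors_pos[OF _ \<sigma>] by metis+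
  have G: "G \<in> christoffel" using assms by (simp add: Z_def)
  have \<sigma>2: "\<sigma> * \<sigma> = 1" using \<sigma> by auto
  define k where "k = sqrt (2 / (\<sigma> * A))"
  define \<Delta> where "\<Delta> = (\<sigma> * A) * (A * C - B\<^sup>2)"
  define n where "n = sqrt (2 / \<Delta>)"
  have "\<Delta> > 0" using pos by (simp add: \<Delta>_def)
  then have "n\<^sup>2 * \<Delta> = 2" "n \<noteq> 0" by (simp_all add: n_def)
  have k: "k\<^sup>2 * (\<sigma> * A) = 2" "k \<noteq> 0" using pos by (auto simp: k_def)
  have n: "n\<^sup>2 * ((\<sigma> * A) * (A * C - B\<^sup>2)) = 2"
    using \<open>n\<^sup>2 * \<Delta> = 2\<close> by (simp add: \<Delta>_def)
  have *: "k * (n * A) - 0 * (- n * B) \<noteq> 0" using pos k \<open>n \<noteq> 0\<close> by auto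
  have "A * k\<^sup>2 + 2 * B * k * 0 + C * 0\<^sup>2 = 2 * \<sigma>"
    "A * k * (- n * B) + B * (k * (n * A) + 0 * (- n * B)) + C * 0 * (n * A) = 0"
    "A * (- n * B)\<^sup>2 + 2 * B * (- n * B) * (n * A) + C * (n * A)\<^sup>2 = 2 * \<sigma>"
  proof -
    have 1: "\<sigma> * \<sigma> * z = z" for z using \<sigma>2 by simp
    have "A * k\<^sup>2 = \<sigma> * (k\<^sup>2 * (\<sigma> * A))" using 1[of "A * k\<^sup>2"] by (simp only: ac_simps)
    then show "A * k\<^sup>2 + 2 * B * k * 0 + C * 0\<^sup>2 = 2 * \<sigma>" using k(1) by simp
    have "A * (- n * B)\<^sup>2 + 2 * B * (- n * B) * (n * A) + C * (n * A)\<^sup>2 = n\<^sup>2 * A * (A * C - B\<^sup>2)"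
      by (simp add: algebra_simps power2_eq_square)
    also have "\<dots> = \<sigma> * (n\<^sup>2 * ((\<sigma> * A) * (A * C - B\<^sup>2)))"
      using 1[of "n\<^sup>2 * A * (A * C - B\<^sup>2)"] by (simp only: ac_simps)
    finally show "A * (- n * B)\<^sup>2 + 2 * B * (- n * B) * (n * A) + C * (n * A)\<^sup>2 = 2 * \<sigma>"
      by (simp only: n mult.commute[of \<sigma> 2])
  qed simp
  then show thesis using ricci_congruence[OF G r *] that by metis
qed

subsection \<open>Indefinite Ricci tensor\<close>

text \<open>The paper's \<open>(\<psi>\<^sub>3, \<Psi>\<^sub>3)\<close> as a function of \<open>(p, r)\<close>.\<close>

definition Theta_of :: "real \<Rightarrow> real \<times> real \<Rightarrow> real \<times> real" where
  "Theta_of \<sigma> = (\<lambda>(p, r). (8 * \<sigma> * p - 2, 8 * p\<^sup>2 - 4 * \<sigma> * p + 1 - 4 * r))"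

text \<open>The vanishing diagonal entries form a homogeneous linear system in \<open>a - d\<close>
  and \<open>f - c\<close>, whose determinant \<open>c * d - b * e\<close> is the off-diagonal entry
  \<open>1\<close>.\<close>

lemma null_array_cases:
  assumes "H \<in> christoffel" "ricci H = vector [vector [0, 1], vector [1, 0]]"
  obtains b c d e where "H = array d b c d e c" "c * d - b * e = 1"
proof -
  obtain a b c d e f where H: "H = array a b c d e f" using assms(1) by (rule christoffel_array)
  have eqs: "d * (a - d) + b * (f - c) = 0" "c * d - b * e = 1" "e * (a - d) + c * (f - c) = 0"
    using assms(2) by (simp_all add: H ricci_array vector_2_2_eq_iff vector_2)
  have "a = d" "f = c" using eqs by algebra+
  with H eqs that show thesis by blast
qed

lemma Theta_null_array:
  assumes "c * d - b * e = 1"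
  shows "Theta (array d b c d e c) = Theta_of 1 (c * d, b * c ^ 3 + e * d ^ 3)"
proof -
  have r: "ricci (array d b c d e c) = vector [vector [0, 1], vector [1, 0]]"
    using assms by (simp add: ricci_array)
  have inv: "matrix_inv (vector [vector [0, 1], vector [1, 0]] :: real^2^2)
      = vector [vector [0, 1], vector [1, 0]]"
    by (rule matrix_inv_eqI)
       (simp add: vec_eq_iff forall_2 matrix_matrix_mult_def sum_2 vector_2 mat_def)
  have e: "b * e = c * d - 1" using assms by simp
  have "psi3 (array d b c d e c) = 8 * (c * d) - 2"
    using e by (simp add: psi3_def r inv rho3_array sum_2 vector_2 algebra_simps)
  moreover have "Psi3 (array d b c d e c) =
      8 * (c * d)\<^sup>2 - 4 * (c * d) + 1 - 4 * (b * c ^ 3 + e * d ^ 3)"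
  proof -
    \<comment> \<open>The Ricci determinant is \<open>- 1\<close>, hence the reversed sign of the
      determinant of \<open>rho3\<close>.\<close>
    have "Psi3 (array d b c d e c) = (c * d + b * e + c * d + d * c)\<^sup>2
       - (d\<^sup>2 + 2 * b * c + d\<^sup>2) * (c\<^sup>2 + 2 * d * e + c\<^sup>2)"
      by (simp add: Psi3_def r rho3_array det_2 vector_2 power2_eq_square algebra_simps)
    also have "\<dots> = 8 * (c * d)\<^sup>2 - 4 * (c * d) + 1 - 4 * (b * c ^ 3 + e * d ^ 3)"
      using assms by algebra
    finally show ?thesis .
  qed
  ultimately show ?thesis by (simp add: Theta_def Theta_of_def)
qed

lemma null_array_Z:
  assumes "c * d - b * e = 1"
  shows "array d b c d e c \<in> Z Indefinite"
proof -
  have "x = 0" if "\<forall>y :: real^2. x$1 * y$2 + x$2 * y$1 = 0" for x :: "real^2"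
    using that[rule_format, of "vector [1, 0]"] that[rule_format, of "vector [0, 1]"]
    by (simp add: vector_2 vec_eq_iff forall_2)
  moreover have "\<exists>x :: real^2. x$1 * x$2 + x$2 * x$1 > 0"
    by (intro exI[of _ "vector [1, 1]"]) (simp add: vector_2)
  moreover have "\<exists>x :: real^2. x$1 * x$2 + x$2 * x$1 < 0"
    by (intro exI[of _ "vector [1, - 1]"]) (simp add: vector_2)
  ultimately show ?thesis
    using assms by (simp add: Z_def array_christoffel ricci_array quadratic_form_2)
qed

text \<open>This swap and the scaling below generate the isometries of the normalised Ricci form, so
  they are all the freedom that is left.\<close>

lemma null_array_swap: "array d b c d e c \<simeq> array c e d c b d"
  by (rule isomorphic_array[where s = 0 and t = 1 and u = 1 and v = 0]) simp_all

lemma null_array_scale: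
  assumes "k \<noteq> 0"
  shows "array d b c d e c \<simeq>
    array (k * d) (k ^ 3 * b) (c / k) (k * d) (e / k ^ 3) (c / k)"
  by (rule isomorphic_array[where s = k and t = 0 and u = 0 and v = "1 / k"])
     (use assms in \<open>simp_all add: field_simps power2_eq_square power3_eq_cube\<close>)

definition indefinite_region :: "(real \<times> real) set" where
  "indefinite_region = {(p, r). 4 * (p - 1) * p ^ 3 \<le> r\<^sup>2}"

text \<open>For \<open>p \<noteq> 0\<close> the scaling freedom is used up by \<open>c = 1\<close>; then \<open>b\<close> and \<open>e p\<^sup>3\<close> are the larger and
  the smaller root of \<open>t\<^sup>2 - r t + (p - 1) p\<^sup>3\<close>, in an order fixed by swapping the coordinates.\<close>

definition indefinite_form :: "real \<times> real \<Rightarrow> real^2^2^2" where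
  "indefinite_form = (\<lambda>(p, r).
     if p = 0 then array 0 1 (root 3 r) 0 (- 1) (root 3 r)
     else let w = sqrt (r\<^sup>2 - 4 * (p - 1) * p ^ 3)
       in array p ((r + w) / 2) 1 p ((r - w) / (2 * p ^ 3)) 1)"

lemma indefinite_form:
  assumes "x \<in> indefinite_region"
  shows "indefinite_form x \<in> Z Indefinite" "Theta (indefinite_form x) = Theta_of 1 x"
proof -
  obtain p r where x: "x = (p, r)" by (cases x)
  have "\<exists>b c d e. indefinite_form x = array d b c d e c \<and> c * d - b * e = 1 \<and>
      p = c * d \<and> r = b * c ^ 3 + e * d ^ 3"
  proof (cases "p = 0")
    case True
    \<comment> \<open>For \<open>p = 0\<close> the choice \<open>d = 0\<close>, \<open>b = 1\<close>
      forces \<open>e = - 1\<close> and leaves \<open>r = c ^ 3\<close>.\<close>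
    have "root 3 r ^ 3 = r" by (simp add: odd_real_root_pow)
    show ?thesis
      by (rule exI[of _ 1], rule exI[of _ "root 3 r"], rule exI[of _ 0], rule exI[of _ "- 1"])
         (use True \<open>root 3 r ^ 3 = r\<close> in \<open>simp add: x indefinite_form_def\<close>)
  next
    case False
    define w where "w = sqrt (r\<^sup>2 - 4 * (p - 1) * p ^ 3)"
    have w: "w\<^sup>2 = r\<^sup>2 - 4 * (p - 1) * p ^ 3"
      using assms by (simp add: w_def x indefinite_region_def)
    have "(r + w) / 2 * ((r - w) / (2 * p ^ 3)) = (r\<^sup>2 - w\<^sup>2) / (4 * p ^ 3)"
      by (simp add: algebra_simps power2_eq_square)
    also have "\<dots> = p - 1" using False by (simp add: w)
    finally have 1: "1 * p - (r + w) / 2 * ((r - w) / (2 * p ^ 3)) = 1" by simp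
    have 2: "r = (r + w) / 2 * 1 ^ 3 + (r - w) / (2 * p ^ 3) * p ^ 3"
      using False by (simp add: field_simps)
    show ?thesis
      by (rule exI[of _ "(r + w) / 2"], rule exI[of _ 1], rule exI[of _ p],
          rule exI[of _ "(r - w) / (2 * p ^ 3)"])
         (use False 1 2 in \<open>simp add: x indefinite_form_def w_def Let_def\<close>)
  qed
  then show "indefinite_form x \<in> Z Indefinite" "Theta (indefinite_form x) = Theta_of 1 x"
    using null_array_Z Theta_null_array x by metis+
qed

text \<open>The discriminant is the square of \<open>b * c ^ 3 - e * d ^ 3\<close>. If
  \<open>c * d\<close> is nonzero, a swap puts the larger term first and scaling by \<open>c\<close>
  gives the form; otherwise a swap reduces to \<open>d = 0\<close>, where scaling normalises
  \<open>b\<close>.\<close>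

lemma null_array_isomorphic_form:
  assumes n: "c * d - b * e = 1"
  shows "(c * d, b * c ^ 3 + e * d ^ 3) \<in> indefinite_region"
    and "array d b c d e c \<simeq> indefinite_form (c * d, b * c ^ 3 + e * d ^ 3)"
proof -
  have disc: "(b * c ^ 3 + e * d ^ 3)\<^sup>2 - 4 * (c * d - 1) * (c * d) ^ 3 = (b * c ^ 3 - e * d ^ 3)\<^sup>2"
    if "c * d - b * e = 1" for b c d e :: real
    using that by algebra
  have "4 * (c * d - 1) * (c * d) ^ 3 \<le> (b * c ^ 3 + e * d ^ 3)\<^sup>2"
    using disc[OF n] zero_le_power2[of "b * c ^ 3 - e * d ^ 3"] by linarith
  then show "(c * d, b * c ^ 3 + e * d ^ 3) \<in> indefinite_region"
    by (simp add: indefinite_region_def)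
  have nz: "array d b c d e c \<simeq> indefinite_form (c * d, b * c ^ 3 + e * d ^ 3)"
    if "c * d \<noteq> 0" "c * d - b * e = 1" "e * d ^ 3 \<le> b * c ^ 3" for b c d e
  proof -
    have w: "sqrt ((b * c ^ 3 + e * d ^ 3)\<^sup>2 - 4 * (c * d - 1) * (c * d) ^ 3) = b * c ^ 3 - e * d ^ 3"
      unfolding disc[OF that(2)] using that by simp
    have u: "(b * c ^ 3 + e * d ^ 3 + (b * c ^ 3 - e * d ^ 3)) / 2 = c ^ 3 * b" by simp
    have v: "(b * c ^ 3 + e * d ^ 3 - (b * c ^ 3 - e * d ^ 3)) / (2 * (c * d) ^ 3) = e / c ^ 3"
      using that(1) by (simp add: power_mult_distrib)
    have "indefinite_form (c * d, b * c ^ 3 + e * d ^ 3) =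
        array (c * d) (c ^ 3 * b) (c / c) (c * d) (e / c ^ 3) (c / c)"
      unfolding indefinite_form_def prod.case Let_def w u v using that(1) by simp
    then show ?thesis using null_array_scale[of c d b c e] that(1) by simp
  qed
  have z: "array d b c d e c \<simeq> indefinite_form (c * d, b * c ^ 3 + e * d ^ 3)"
    if "d = 0" "c * d - b * e = 1" for b c d e
  proof -
    \<comment> \<open>Scaling by \<open>1 / root 3 b\<close> turns \<open>b\<close> into
      \<open>1\<close> and \<open>e\<close> into \<open>b * e = - 1\<close>.\<close>
    have be: "b * e = - 1" "b \<noteq> 0" using that by auto
    have rb: "root 3 b ^ 3 = b" "root 3 b \<noteq> 0" using be by (simp_all add: odd_real_root_pow)
    have "root 3 (b * c ^ 3) = root 3 b * c"
      by (simp add: real_root_mult odd_real_root_power_cancel)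
    then have "indefinite_form (c * d, b * c ^ 3 + e * d ^ 3) = array (1 / root 3 b * d)
        ((1 / root 3 b) ^ 3 * b) (c / (1 / root 3 b)) (1 / root 3 b * d) (e / (1 / root 3 b) ^ 3)
        (c / (1 / root 3 b))"
      using be that rb by (simp add: indefinite_form_def power_divide mult.commute)
    then show ?thesis using null_array_scale[of "1 / root 3 b" d b c e] rb by simp
  qed
  show "array d b c d e c \<simeq> indefinite_form (c * d, b * c ^ 3 + e * d ^ 3)"
  proof -
    have comm: "(d * c, e * d ^ 3 + b * c ^ 3) = (c * d, b * c ^ 3 + e * d ^ 3)"
      by (simp add: algebra_simps)
    have n': "d * c - e * b = 1" using n by (simp add: algebra_simps)
    have swap: ?thesis if "array c e d c b d \<simeq> indefinite_form (d * c, e * d ^ 3 + b * c ^ 3)"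
      using that null_array_swap[of d b c e] isomorphic_trans unfolding comm by blast
    consider "c * d \<noteq> 0" "e * d ^ 3 \<le> b * c ^ 3" | "d * c \<noteq> 0" "b * c ^ 3 \<le> e * d ^ 3"
      | "d = 0" | "c = 0" by force
    then show ?thesis
    proof cases
      case 1 then show ?thesis using nz n by blast
    next
      case 2 show ?thesis by (rule swap, rule nz) (use 2 n' in auto)
    next
      case 3 then show ?thesis using z n by blast
    next
      case 4 show ?thesis by (rule swap, rule z) (use 4 n' in auto)
    qed
  qed
qed

lemma indefinite_reduction:
  assumes "G \<in> Z Indefinite"
  shows "\<exists>x \<in> indefinite_region. G \<simeq> indefinite_form x"
proof -
  obtain H where H: "H \<in> christoffel" "ricci H = vector [vector [0, 1], vector [1, 0]]" and GH: "G \<simeq> H"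
    using indefinite_ricci_normalized[OF assms] by blast
  obtain b c d e where "H = array d b c d e c" "c * d - b * e = 1"
    using H by (rule null_array_cases)
  then show ?thesis using null_array_isomorphic_form isomorphic_trans[OF GH] by blast
qed

subsection \<open>Definite Ricci tensor\<close>

text \<open>Eliminating \<open>f - c\<close> or \<open>a - d\<close> from the two equal diagonal
  entries leaves a multiple of the vanishing off-diagonal entry, whence \<open>b = c\<close> and
  \<open>d = e\<close>. The array then holds the coefficients of the cubic
  \<open>a x^3 + 3 b x^2 y + 3 d x y^2 + f y^3\<close>.\<close>

lemma symmetric_array_cases:
  assumes "H \<in> christoffel" "ricci H = vector [vector [2 * \<sigma>, 0], vector [0, 2 * \<sigma>]]" "\<sigma> \<noteq> 0"
  obtains a b d f where "H = array a b b d d f" "d * (a - d) + b * (f - b) = 2 * \<sigma>"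
proof -
  obtain a b c d e f where H: "H = array a b c d e f" using assms(1) by (rule christoffel_array)
  have eqs: "d * (a - d) + b * (f - c) = 2 * \<sigma>" "c * d - b * e = 0" "e * (a - d) + c * (f - c) = 2 * \<sigma>"
    using assms(2) by (simp_all add: H ricci_array vector_2_2_eq_iff vector_2)
  have "2 * \<sigma> * b = 2 * \<sigma> * c" "2 * \<sigma> * d = 2 * \<sigma> * e" using eqs by algebra+
  with H eqs \<open>\<sigma> \<noteq> 0\<close> that show thesis by simp
qed

text \<open>The primed numbers are the polarised cubic form evaluated on the orthonormal frame
  \<open>(x, y)\<close>, \<open>(- y, x)\<close>.\<close>

lemma symmetric_array_rotate:
  assumes "x\<^sup>2 + y\<^sup>2 = 1"
    and "a' = a * x ^ 3 + 3 * b * x\<^sup>2 * y + 3 * d * x * y\<^sup>2 + f * y ^ 3"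
    and "b' = - a * x\<^sup>2 * y + b * (x ^ 3 - 2 * x * y\<^sup>2) + d * (2 * x\<^sup>2 * y - y ^ 3) + f * x * y\<^sup>2"
    and "d' = a * x * y\<^sup>2 + b * (y ^ 3 - 2 * x\<^sup>2 * y) + d * (x ^ 3 - 2 * x * y\<^sup>2) + f * x\<^sup>2 * y"
    and "f' = - a * y ^ 3 + 3 * b * x * y\<^sup>2 - 3 * d * x\<^sup>2 * y + f * x ^ 3"
  shows "array a b b d d f \<simeq> array a' b' b' d' d' f'"
proof (rule isomorphic_array[where s = x and t = y and u = "- y" and v = x])
  show "x * x - y * - y \<noteq> 0" using assms(1) by (simp add: power2_eq_square)
  \<comment> \<open>The frame equations hold only modulo \<open>x\<^sup>2 + y\<^sup>2 = 1\<close>,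
    so this factor is made explicit on each right-hand side.\<close>
  have 1: "(x\<^sup>2 + y\<^sup>2) * z = z" for z using assms(1) by simp
  note expand = assms(2-5) algebra_simps power2_eq_square power3_eq_cube
  have "a' * x + b' * - y = (x\<^sup>2 + y\<^sup>2) * (x\<^sup>2 * a + 2 * x * y * b + y\<^sup>2 * d)"
    by (simp add: expand)
  then show "a' * x + b' * - y = x\<^sup>2 * a + 2 * x * y * b + y\<^sup>2 * d" by (simp only: 1)
  have "a' * y + b' * x = (x\<^sup>2 + y\<^sup>2) * (x\<^sup>2 * b + 2 * x * y * d + y\<^sup>2 * f)"
    by (simp add: expand)
  then show "a' * y + b' * x = x\<^sup>2 * b + 2 * x * y * d + y\<^sup>2 * f" by (simp only: 1)
  have "b' * x + d' * - y = (x\<^sup>2 + y\<^sup>2) * (x * - y * a + (x * x + y * - y) * b + y * x * d)"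
    by (simp add: expand)
  then show "b' * x + d' * - y = x * - y * a + (x * x + y * - y) * b + y * x * d" by (simp only: 1)
  have "b' * y + d' * x = (x\<^sup>2 + y\<^sup>2) * (x * - y * b + (x * x + y * - y) * d + y * x * f)"
    by (simp add: expand)
  then show "b' * y + d' * x = x * - y * b + (x * x + y * - y) * d + y * x * f" by (simp only: 1)
  have "d' * x + f' * - y = (x\<^sup>2 + y\<^sup>2) * ((- y)\<^sup>2 * a + 2 * - y * x * b + x\<^sup>2 * d)"
    by (simp add: expand)
  then show "d' * x + f' * - y = (- y)\<^sup>2 * a + 2 * - y * x * b + x\<^sup>2 * d" by (simp only: 1)
  have "d' * y + f' * x = (x\<^sup>2 + y\<^sup>2) * ((- y)\<^sup>2 * b + 2 * - y * x * d + x\<^sup>2 * f)"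
    by (simp add: expand)
  then show "d' * y + f' * x = (- y)\<^sup>2 * b + 2 * - y * x * d + x\<^sup>2 * f" by (simp only: 1)
qed

lemma symmetric_array_reflect: "array a b b d d f \<simeq> array a (- b) (- b) d d (- f)"
  by (rule isomorphic_array[where s = 1 and t = 0 and u = 0 and v = "- 1"]) simp_all

text \<open>The cubic is split into the trace part \<open>3 m x (x^2 + y^2)\<close> and the harmonic
  part \<open>h (x^3 - 3 x y^2) + b (3 x^2 y - y^3)\<close>. In these parameters the Ricci
  normalisation reads \<open>m\<^sup>2 - h\<^sup>2 - b\<^sup>2 = \<sigma>\<close>.\<close>

lemma Theta_symmetric_array:
  assumes n: "m\<^sup>2 - h\<^sup>2 - b\<^sup>2 = \<sigma>" and \<sigma>: "\<sigma> * \<sigma> = 1"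
  shows "Theta (array (3 * m + h) b b (m - h) (m - h) (- b)) = Theta_of \<sigma> (m\<^sup>2, 2 * m ^ 3 * h)"
proof -
  define G where "G = array (3 * m + h) b b (m - h) (m - h) (- b)"
  have r: "ricci G = vector [vector [2 * \<sigma>, 0], vector [0, 2 * \<sigma>]]"
    using n by (simp add: G_def ricci_array vector_2_2_eq_iff vector_2 algebra_simps power2_eq_square)
  have inv: "matrix_inv (vector [vector [2 * \<sigma>, 0], vector [0, 2 * \<sigma>]] :: real^2^2)
      = vector [vector [\<sigma> / 2, 0], vector [0, \<sigma> / 2]]"
    by (rule matrix_inv_eqI)
       (simp add: vec_eq_iff forall_2 matrix_matrix_mult_def sum_2 vector_2 mat_def \<sigma>)
  have "psi3 G = \<sigma> / 2 * ((3 * m + h)\<^sup>2 + 2 * b * b + (m - h)\<^sup>2)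
      + \<sigma> / 2 * (b\<^sup>2 + 2 * (m - h) * (m - h) + (- b)\<^sup>2)"
    unfolding psi3_def r inv by (simp add: G_def rho3_array sum_2 vector_2)
  also have "\<dots> = \<sigma> * (8 * m\<^sup>2 - 2 * (m\<^sup>2 - h\<^sup>2 - b\<^sup>2))"
    by (simp add: algebra_simps power2_eq_square)
  also have "\<dots> = 8 * \<sigma> * m\<^sup>2 - 2 * (\<sigma> * \<sigma>)" unfolding n by (simp only: algebra_simps)
  finally have psi: "psi3 G = 8 * \<sigma> * m\<^sup>2 - 2" by (simp add: \<sigma>)
  have "det (ricci G) = 4 * (\<sigma> * \<sigma>)" by (simp add: r det_2 vector_2)
  then have "4 * Psi3 G = det (rho3 G)" by (simp add: Psi3_def \<sigma>)
  also have "\<dots> = ((3 * m + h)\<^sup>2 + 2 * b * b + (m - h)\<^sup>2) * (b\<^sup>2 + 2 * (m - h) * (m - h) + (- b)\<^sup>2)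
      - ((3 * m + h) * b + b * (m - h) + b * (m - h) + (m - h) * (- b))\<^sup>2"
    by (simp add: G_def rho3_array det_2 vector_2 power2_eq_square)
  \<comment> \<open>The constant \<open>1\<close> is kept as \<open>\<sigma> * \<sigma>\<close>, so
    that substituting for \<sigma> yields a polynomial identity.\<close>
  also have "\<dots> = 4 * (8 * (m\<^sup>2)\<^sup>2 - 4 * \<sigma> * m\<^sup>2 + \<sigma> * \<sigma> - 4 * (2 * m ^ 3 * h))"
    unfolding n[symmetric] by (simp add: algebra_simps power2_eq_square power3_eq_cube)
  also have "\<dots> = 4 * (8 * (m\<^sup>2)\<^sup>2 - 4 * \<sigma> * m\<^sup>2 + 1 - 4 * (2 * m ^ 3 * h))"
    by (simp only: \<sigma>)
  finally show ?thesis using psi by (simp add: Theta_def Theta_of_def G_def)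
qed

lemma symmetric_array_Z:
  assumes n: "m\<^sup>2 - h\<^sup>2 - b\<^sup>2 = \<sigma>" and \<sigma>: "\<epsilon> = Positive \<and> \<sigma> = 1 \<or> \<epsilon> = Negative \<and> \<sigma> = - 1"
  shows "array (3 * m + h) b b (m - h) (m - h) (- b) \<in> Z \<epsilon>"
proof -
  have r: "ricci (array (3 * m + h) b b (m - h) (m - h) (- b))
      = vector [vector [2 * \<sigma>, 0], vector [0, 2 * \<sigma>]]"
    using n by (simp add: ricci_array vector_2_2_eq_iff vector_2 algebra_simps power2_eq_square)
  have q: "x \<bullet> (vector [vector [2 * \<sigma>, 0], vector [0, 2 * \<sigma>]] *v x) = 2 * \<sigma> * (x \<bullet> x)"
    for x :: "real^2"
    unfolding quadratic_form_2 by (simp add: inner_vec_def sum_2 algebra_simps)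
  have "has_definiteness Positive (vector [vector [2 * \<sigma>, 0], vector [0, 2 * \<sigma>]])" if "\<sigma> = 1"
    unfolding has_definiteness.simps q using that by simp
  moreover have "has_definiteness Negative (vector [vector [2 * \<sigma>, 0], vector [0, 2 * \<sigma>]])" if "\<sigma> = - 1"
    unfolding has_definiteness.simps q using that by simp
  ultimately show ?thesis using \<sigma> unfolding Z_def mem_Collect_eq r by (metis array_christoffel)
qed

definition definite_region :: "real \<Rightarrow> (real \<times> real) set" where
  "definite_region \<sigma> = {(p, r). 0 \<le> p \<and> \<sigma> \<le> p \<and> r\<^sup>2 \<le> 4 * (p - \<sigma>) * p ^ 3}"

text \<open>The rotation is used up by making the trace covector a non-negative multiple \<open>4 m\<close> of the first
  basis covector. If \<open>p = 0\<close>, it vanishes and a rotation makes \<open>h = 0\<close> instead, which is also what the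
  division by zero gives.\<close>

definition definite_form :: "real \<Rightarrow> real \<times> real \<Rightarrow> real^2^2^2" where
  "definite_form \<sigma> = (\<lambda>(p, r).
     let m = sqrt p; h = r / (2 * m ^ 3); b = sqrt (p - \<sigma> - h\<^sup>2)
     in array (3 * m + h) b b (m - h) (m - h) (- b))"

lemma definite_form:
  assumes x: "x \<in> definite_region \<sigma>" and \<sigma>: "\<epsilon> = Positive \<and> \<sigma> = 1 \<or> \<epsilon> = Negative \<and> \<sigma> = - 1"
  shows "definite_form \<sigma> x \<in> Z \<epsilon>" "Theta (definite_form \<sigma> x) = Theta_of \<sigma> x"
proof -
  obtain p r where x': "x = (p, r)" by (cases x)
  have R: "0 \<le> p" "\<sigma> \<le> p" "r\<^sup>2 \<le> 4 * (p - \<sigma>) * p ^ 3"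
    using x by (simp_all add: x' definite_region_def)
  define m where "m = sqrt p"
  define h where "h = r / (2 * m ^ 3)"
  define b where "b = sqrt (p - \<sigma> - h\<^sup>2)"
  have m: "m\<^sup>2 = p" using R by (simp add: m_def)
  \<comment> \<open>If \<open>p = 0\<close>, the region forces \<open>r = 0\<close>, which agrees
    with \<open>h = 0\<close> from the division by zero.\<close>
  have r: "2 * m ^ 3 * h = r"
    using R m by (cases "p = 0") (auto simp: h_def)
  have "h\<^sup>2 \<le> p - \<sigma>"
  proof (cases "p = 0")
    case True
    then show ?thesis using R m by (simp add: h_def)
  next
    case False
    have m6: "4 * p ^ 3 = (2 * m ^ 3)\<^sup>2" by (simp add: m[symmetric] power_mult_distrib flip: power_mult)
    have pos: "4 * p ^ 3 > 0" using False R by simp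
    have "4 * p ^ 3 * h\<^sup>2 = r\<^sup>2" unfolding m6 r[symmetric] by (simp only: power_mult_distrib)
    also have "\<dots> \<le> 4 * p ^ 3 * (p - \<sigma>)" using R(3) by (simp only: ac_simps)
    finally show ?thesis by (rule mult_left_le_imp_le[OF _ pos])
  qed
  then have "b\<^sup>2 = p - \<sigma> - h\<^sup>2" by (simp add: b_def)
  then have n: "m\<^sup>2 - h\<^sup>2 - b\<^sup>2 = \<sigma>" using m by simp
  have f: "definite_form \<sigma> x = array (3 * m + h) b b (m - h) (m - h) (- b)"
    by (simp add: definite_form_def x' Let_def m_def h_def b_def)
  show "definite_form \<sigma> x \<in> Z \<epsilon>" unfolding f by (rule symmetric_array_Z[OF n \<sigma>])
  have "\<sigma> * \<sigma> = 1" using \<sigma> by auto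
  then show "Theta (definite_form \<sigma> x) = Theta_of \<sigma> x"
    unfolding f Theta_symmetric_array[OF n \<open>\<sigma> * \<sigma> = 1\<close>] by (simp add: x' r m)
qed

text \<open>The rotation takes the trace covector \<open>(a + d, b + f)\<close> to the first axis.
  Eight times \<open>d * (a - d) + b * (f - b)\<close> is the squared length of that covector minus
  that of \<open>(a - 3 * d, 3 * b - f)\<close>, and rotations preserve both lengths.\<close>

lemma symmetric_array_trace_rotate:
  fixes a b d f :: real
  obtains a' b' d' where "array a b b d d f \<simeq> array a' b' b' d' d' (- b')" "a' + d' \<ge> 0"
    "d' * (a' - d') - 2 * b'\<^sup>2 = d * (a - d) + b * (f - b)"
proof -
  define w where "w = sqrt ((a + d)\<^sup>2 + (b + f)\<^sup>2)"
  have w: "w\<^sup>2 = (a + d)\<^sup>2 + (b + f)\<^sup>2" "w \<ge> 0" by (simp_all add: w_def)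
  have "\<exists>x y. x\<^sup>2 + y\<^sup>2 = 1 \<and> x * w = a + d \<and> y * w = b + f"
  proof (cases "w = 0")
    case True
    then show ?thesis using w by (intro exI[of _ 1] exI[of _ 0]) (simp add: sum_power2_eq_zero_iff)
  next
    case False
    then show ?thesis using w
      by (intro exI[of _ "(a + d) / w"] exI[of _ "(b + f) / w"])
         (simp add: power_divide add_divide_distrib[symmetric] w(1)[symmetric])
  qed
  then obtain x y where xy: "x\<^sup>2 + y\<^sup>2 = 1" "x * w = a + d" "y * w = b + f" by blast
  define a' where "a' = a * x ^ 3 + 3 * b * x\<^sup>2 * y + 3 * d * x * y\<^sup>2 + f * y ^ 3"
  define b' where "b' = - a * x\<^sup>2 * y + b * (x ^ 3 - 2 * x * y\<^sup>2) + d * (2 * x\<^sup>2 * y - y ^ 3) + f * x * y\<^sup>2"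
  define d' where "d' = a * x * y\<^sup>2 + b * (y ^ 3 - 2 * x\<^sup>2 * y) + d * (x ^ 3 - 2 * x * y\<^sup>2) + f * x\<^sup>2 * y"
  define f' where "f' = - a * y ^ 3 + 3 * b * x * y\<^sup>2 - 3 * d * x\<^sup>2 * y + f * x ^ 3"
  note primes = a'_def b'_def d'_def f'_def algebra_simps power2_eq_square power3_eq_cube
  have "b' + f' = (x\<^sup>2 + y\<^sup>2) * (x * (b + f) - y * (a + d))" by (simp add: primes)
  also have "\<dots> = 0" by (simp add: xy(2,3)[symmetric])
  finally have f: "f' = - b'" by simp
  have "a' + d' = (x\<^sup>2 + y\<^sup>2) * (x * (a + d) + y * (b + f))" by (simp add: primes)
  also have "\<dots> = (x\<^sup>2 + y\<^sup>2) * (x\<^sup>2 + y\<^sup>2) * w"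
    by (simp add: xy(2,3)[symmetric] algebra_simps power2_eq_square)
  finally have tr: "a' + d' = w" by (simp add: xy(1))
  have "array a b b d d f \<simeq> array a' b' b' d' d' (- b')"
    using symmetric_array_rotate[OF xy(1) a'_def b'_def d'_def f'_def] by (simp add: f)
  moreover have "d' * (a' - d') - 2 * b'\<^sup>2 = d * (a - d) + b * (f - b)"
  proof -
    \<comment> \<open>The trace-free part of the cubic form rotates by three times the angle.\<close>
    define C where "C = x ^ 3 - 3 * x * y\<^sup>2"
    define S where "S = 3 * x\<^sup>2 * y - y ^ 3"
    have h: "a' - 3 * d' = (a - 3 * d) * C + (3 * b - f) * S"
      "3 * b' - f' = (3 * b - f) * C - (a - 3 * d) * S"
      by (simp_all add: primes C_def S_def)
    have "C\<^sup>2 + S\<^sup>2 = (x\<^sup>2 + y\<^sup>2) ^ 3"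
      by (simp add: C_def S_def algebra_simps power2_eq_square power3_eq_cube)
    then have CS: "C\<^sup>2 + S\<^sup>2 = 1" by (simp add: xy(1))
    have "(a' - 3 * d')\<^sup>2 + (3 * b' - f')\<^sup>2 = (C\<^sup>2 + S\<^sup>2) * ((a - 3 * d)\<^sup>2 + (3 * b - f)\<^sup>2)"
      unfolding h by algebra
    then have "(a' - 3 * d')\<^sup>2 + (3 * b' - f')\<^sup>2 = (a - 3 * d)\<^sup>2 + (3 * b - f)\<^sup>2"
      by (simp add: CS)
    moreover have "(a' + d')\<^sup>2 = (a + d)\<^sup>2 + (b + f)\<^sup>2" by (simp add: tr w(1))
    ultimately show ?thesis by (simp add: f algebra_simps power2_eq_square)
  qed
  ultimately show thesis using that tr w(2) by simp
qed

text \<open>On harmonic cubics a rotation acts by three times its angle, so a complex cube root of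
  \<open>b - i h\<close> supplies the rotation.\<close>

lemma harmonic_array_rotate:
  assumes "h\<^sup>2 + b\<^sup>2 = 1"
  shows "array h b b (- h) (- h) (- b) \<simeq> array 0 1 1 0 0 (- 1)"
proof -
  have "b\<^sup>2 + (- h)\<^sup>2 = 1" using assms by simp
  then obtain t where t: "b = cos t" "- h = sin t" using sincos_total_2pi by metis
  define z where "z = cis (t / 3)"
  have z3: "z ^ 3 = cis t" by (simp add: z_def Complex.DeMoivre)
  define x where "x = Re z"
  define y where "y = Im z"
  have "Re (z ^ 3) = x ^ 3 - 3 * x * y\<^sup>2" "Im (z ^ 3) = 3 * x\<^sup>2 * y - y ^ 3"
    by (simp_all add: x_def y_def power3_eq_cube power2_eq_square algebra_simps)
  then have 3: "x ^ 3 - 3 * x * y\<^sup>2 = b" "3 * x\<^sup>2 * y - y ^ 3 = - h"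
    using t by (simp_all add: z3)
  have 0: "h * (x ^ 3 - 3 * x * y\<^sup>2) + b * (3 * x\<^sup>2 * y - y ^ 3) = 0"
    and 1: "b * (x ^ 3 - 3 * x * y\<^sup>2) - h * (3 * x\<^sup>2 * y - y ^ 3) = 1"
    using assms unfolding 3 by (simp_all add: power2_eq_square)
  have "x\<^sup>2 + y\<^sup>2 = 1" by (simp add: x_def y_def z_def)
  then show ?thesis
    by (rule symmetric_array_rotate) (use 0 1 in \<open>simp_all add: algebra_simps\<close>)
qed

text \<open>For \<open>m > 0\<close> the form recovers \<open>m\<close> and \<open>h\<close> and
  loses only the sign of \<open>b\<close>, which a reflection restores. For \<open>m = 0\<close> the
  cubic is harmonic and its phase is rotated away.\<close>

lemma symmetric_array_isomorphic_form:
  assumes n: "m\<^sup>2 - h\<^sup>2 - b\<^sup>2 = \<sigma>" and m: "m \<ge> 0" and \<sigma>: "\<sigma> = 1 \<or> \<sigma> = - 1"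
  shows "(m\<^sup>2, 2 * m ^ 3 * h) \<in> definite_region \<sigma>"
    and "array (3 * m + h) b b (m - h) (m - h) (- b) \<simeq> definite_form \<sigma> (m\<^sup>2, 2 * m ^ 3 * h)"
proof -
  have nb: "m\<^sup>2 - \<sigma> - h\<^sup>2 = b\<^sup>2" using n by simp
  have "4 * (m\<^sup>2 - \<sigma>) * (m\<^sup>2) ^ 3 - (2 * m ^ 3 * h)\<^sup>2 = 4 * (m ^ 3)\<^sup>2 * b\<^sup>2"
  proof -
    have "4 * (m\<^sup>2 - \<sigma>) * (m\<^sup>2) ^ 3 - (2 * m ^ 3 * h)\<^sup>2 = 4 * (m ^ 3)\<^sup>2 * (m\<^sup>2 - \<sigma> - h\<^sup>2)"
      by (simp add: algebra_simps power2_eq_square power3_eq_cube)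
    then show ?thesis by (simp only: nb)
  qed
  moreover have "4 * (m ^ 3)\<^sup>2 * b\<^sup>2 \<ge> 0" by simp
  ultimately have "(2 * m ^ 3 * h)\<^sup>2 \<le> 4 * (m\<^sup>2 - \<sigma>) * (m\<^sup>2) ^ 3" by linarith
  moreover have "\<sigma> \<le> m\<^sup>2" using nb zero_le_power2[of b] zero_le_power2[of h] by linarith
  ultimately show "(m\<^sup>2, 2 * m ^ 3 * h) \<in> definite_region \<sigma>" by (simp add: definite_region_def)
  show "array (3 * m + h) b b (m - h) (m - h) (- b) \<simeq> definite_form \<sigma> (m\<^sup>2, 2 * m ^ 3 * h)"
  proof (cases "m = 0")
    case True
    with n \<sigma> have "\<sigma> = - 1" using zero_le_power2[of b] zero_le_power2[of h] by auto
    with True n have "h\<^sup>2 + b\<^sup>2 = 1" by simp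
    from harmonic_array_rotate[OF this] show ?thesis
      by (simp add: True \<open>\<sigma> = - 1\<close> definite_form_def)
  next
    case False
    then have "definite_form \<sigma> (m\<^sup>2, 2 * m ^ 3 * h) =
        array (3 * m + h) \<bar>b\<bar> \<bar>b\<bar> (m - h) (m - h) (- \<bar>b\<bar>)"
      using m by (simp add: definite_form_def Let_def nb)
    then show ?thesis
      using symmetric_array_reflect[of "3 * m + h" b "m - h" "- b"] isomorphic_refl
      by (cases "b \<ge> 0") auto
  qed
qed

lemma definite_reduction:
  assumes G: "G \<in> Z \<epsilon>" and \<sigma>: "\<epsilon> = Positive \<and> \<sigma> = 1 \<or> \<epsilon> = Negative \<and> \<sigma> = - 1"
  shows "\<exists>x \<in> definite_region \<sigma>. G \<simeq> definite_form \<sigma> x"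
proof -
  obtain H where H: "H \<in> christoffel" "ricci H = vector [vector [2 * \<sigma>, 0], vector [0, 2 * \<sigma>]]"
    and GH: "G \<simeq> H"
    using definite_ricci_normalized[OF assms] by blast
  have "\<sigma> \<noteq> 0" and \<sigma>': "\<sigma> = 1 \<or> \<sigma> = - 1" using \<sigma> by auto
  with H obtain a b d f where H': "H = array a b b d d f" "d * (a - d) + b * (f - b) = 2 * \<sigma>"
    using symmetric_array_cases by metis
  obtain a' b' d' where *: "array a b b d d f \<simeq> array a' b' b' d' d' (- b')" "a' + d' \<ge> 0"
    "d' * (a' - d') - 2 * b'\<^sup>2 = 2 * \<sigma>"
    using symmetric_array_trace_rotate[of a b d f] H'(2) by metis
  \<comment> \<open>These are the trace and harmonic parameters, obtained by solving
    \<open>a' = 3 * m + h\<close>, \<open>d' = m - h\<close>.\<close>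
  define m where "m = (a' + d') / 4"
  define h where "h = (a' - 3 * d') / 4"
  have mh: "a' = 3 * m + h" "d' = m - h" by (simp_all add: m_def h_def field_simps)
  have "m\<^sup>2 - h\<^sup>2 - b'\<^sup>2 = \<sigma>" using *(3) unfolding mh by (simp add: algebra_simps power2_eq_square)
  moreover have "m \<ge> 0" using *(2) by (simp add: m_def)
  ultimately show ?thesis
    using symmetric_array_isomorphic_form[OF _ _ \<sigma>'] isomorphic_trans[OF GH] isomorphic_trans[OF *(1)]
    unfolding H' mh by blast
qed

subsection \<open>The image in the plane\<close>

text \<open>The map is triangular: its first component is affine in \<open>p\<close>, its second
  affine in \<open>r\<close> for fixed \<open>p\<close>, both with nonzero slope.\<close>

lemma Theta_of_inverse:
  assumes "\<sigma> * \<sigma> = 1"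
  obtains \<Phi> :: "real \<times> real \<Rightarrow> real \<times> real" where "continuous_on UNIV \<Phi>"
    "\<And>x. \<Phi> (Theta_of \<sigma> x) = x" "\<And>y. Theta_of \<sigma> (\<Phi> y) = y"
proof -
  define q where "q = (\<lambda>x. \<sigma> * (x + 2) / 8)"
  define \<Phi> where "\<Phi> = (\<lambda>y :: real \<times> real. (q (fst y), (8 * (q (fst y))\<^sup>2 - 4 * \<sigma> * q (fst y) + 1 - snd y) / 4))"
  have "q (8 * \<sigma> * p - 2) = p" for p using assms by (simp add: q_def)
  then have "\<Phi> (Theta_of \<sigma> x) = x" for x by (cases x) (simp add: \<Phi>_def Theta_of_def)
  moreover have "8 * \<sigma> * q x - 2 = x" for x
  proof -
    have "8 * \<sigma> * q x = (\<sigma> * \<sigma>) * (x + 2)" by (simp add: q_def)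
    then show ?thesis by (simp add: assms)
  qed
  then have "Theta_of \<sigma> (\<Phi> y) = y" for y by (cases y) (simp add: \<Phi>_def Theta_of_def field_simps)
  moreover have "continuous_on UNIV \<Phi>"
    unfolding \<Phi>_def q_def by (intro continuous_intros) auto
  ultimately show thesis using that by blast
qed

section \<open>Topology of the regions\<close>

lemma contractible_two_segments:
  fixes S :: "'a::real_normed_vector set"
  assumes "continuous_on S f" "f ` S \<subseteq> S"
    and "\<And>x. x \<in> S \<Longrightarrow> closed_segment x (f x) \<subseteq> S" "\<And>x. x \<in> S \<Longrightarrow> closed_segment (f x) a \<subseteq> S"
  shows "contractible S"
proof -
  have "homotopic_with_canon (\<lambda>x. True) S S id f"
    by (rule homotopic_with_linear) (use assms in auto)
  moreover have "homotopic_with_canon (\<lambda>x. True) S S f (\<lambda>x. a)"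
    by (rule homotopic_with_linear) (use assms in auto)
  ultimately show ?thesis
    unfolding contractible_def using homotopic_with_trans by blast
qed

text \<open>Points move horizontally to the line \<open>p = 1 / 2\<close>, then along it. The first
  motion stays inside since \<open>(p - 1) * p ^ 3\<close> decreases for \<open>p \<le> 0\<close>,
  increases for \<open>p \<ge> 1\<close> and is at most \<open>0\<close> in between.\<close>

lemma indefinite_region_contractible: "contractible indefinite_region"
proof (rule contractible_two_segments[where f = "\<lambda>(p, r). (1 / 2, r)" and a = "(1 / 2, 0)"])
  have strip: "(p, r) \<in> indefinite_region" if "0 \<le> p" "p \<le> 1" for p r :: real
  proof -
    have "(p - 1) * p ^ 3 \<le> 0" using that by (simp add: mult_le_0_iff)
    moreover have "0 \<le> r\<^sup>2" by simp
    ultimately have "4 * ((p - 1) * p ^ 3) \<le> r\<^sup>2" by linarith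
    then show ?thesis by (simp add: indefinite_region_def algebra_simps)
  qed
  show "continuous_on indefinite_region (\<lambda>(p, r). (1 / 2, r))"
    by (auto simp: case_prod_unfold intro!: continuous_intros)
  show "(\<lambda>(p, r). (1 / 2, r)) ` indefinite_region \<subseteq> indefinite_region"
    by (auto intro: strip)
  show "closed_segment x ((\<lambda>(p, r). (1 / 2, r)) x) \<subseteq> indefinite_region" if "x \<in> indefinite_region" for x
  proof -
    obtain p r where x: "x = (p, r)" by (cases x)
    have le: "4 * (p - 1) * p ^ 3 \<le> r\<^sup>2" using that by (simp add: x indefinite_region_def)
    have "((1 - t) * p + t / 2, r) \<in> indefinite_region" if t: "0 \<le> t" "t \<le> 1" for t
    proof -
      define q where "q = (1 - t) * p + t / 2"
      \<comment> \<open>Both forms are used: \<open>q\<close> is on the same side of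
        \<open>1 / 2\<close> as \<open>p\<close> and no farther away.\<close>
      have q: "q = p - t * (p - 1 / 2)" "q = 1 / 2 + (1 - t) * (p - 1 / 2)"
        by (simp_all add: q_def field_simps)
      consider "0 \<le> q" "q \<le> 1" | "1 < q" | "q < 0" by linarith
      then have "(q, r) \<in> indefinite_region"
      proof cases
        case 1 then show ?thesis by (rule strip)
      next
        case 2
        then have "(1 - t) * (p - 1 / 2) > 0" using q by linarith
        then have "p - 1 / 2 > 0" using t by (simp add: zero_less_mult_iff)
        then have "q \<le> p" using q t by simp
        then have "(q - 1) * q ^ 3 \<le> (p - 1) * p ^ 3"
          using 2 by (intro mult_mono power_mono) auto
        then show ?thesis using le
            unfolding indefinite_region_def mem_Collect_eq prod.case mult.assoc by linarith
      next
        case 3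
        then have "(1 - t) * (p - 1 / 2) < 0" using q by linarith
        then have "p - 1 / 2 < 0" using t by (simp add: mult_less_0_iff)
        then have "p \<le> q" using q t by (simp add: mult_nonneg_nonpos)
        then have "(1 - q) * (- q) ^ 3 \<le> (1 - p) * (- p) ^ 3"
          using 3 by (intro mult_mono power_mono) auto
        then have "(q - 1) * q ^ 3 \<le> (p - 1) * p ^ 3"
          by (simp add: power3_eq_cube algebra_simps)
        then show ?thesis using le
            unfolding indefinite_region_def mem_Collect_eq prod.case mult.assoc by linarith
      qed
      then show ?thesis by (simp add: q_def)
    qed
    then show ?thesis
      by (auto simp: x closed_segment_def algebra_simps)
  qed
  show "closed_segment ((\<lambda>(p, r). (1 / 2, r)) x) (1 / 2, 0) \<subseteq> indefinite_region" for x
    by (cases x) (auto simp: closed_segment_def field_simps intro!: strip)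
qed

text \<open>Points move vertically to the axis \<open>r = 0\<close>, which only shrinks
  \<open>r\<^sup>2\<close>, and then along the axis to \<open>(1, 0)\<close>, a point of the region
  because \<open>\<sigma> \<le> 1\<close>.\<close>

lemma definite_region_contractible:
  assumes \<sigma>: "\<sigma> \<le> 1"
  shows "contractible (definite_region \<sigma>)"
proof (rule contractible_two_segments[where f = "\<lambda>(p, r). (p, 0)" and a = "(1, 0)"])
  have axis: "(p, 0) \<in> definite_region \<sigma>" if "0 \<le> p" "\<sigma> \<le> p" for p
    using that by (simp add: definite_region_def)
  show "continuous_on (definite_region \<sigma>) (\<lambda>(p, r). (p, 0))"
    by (auto simp: case_prod_unfold intro!: continuous_intros)
  show "(\<lambda>(p, r). (p, 0)) ` definite_region \<sigma> \<subseteq> definite_region \<sigma>"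
    by (auto simp: definite_region_def)
  show "closed_segment x ((\<lambda>(p, r). (p, 0)) x) \<subseteq> definite_region \<sigma>" if "x \<in> definite_region \<sigma>" for x
  proof -
    obtain p r where x: "x = (p, r)" by (cases x)
    have R: "0 \<le> p" "\<sigma> \<le> p" "r\<^sup>2 \<le> 4 * (p - \<sigma>) * p ^ 3"
      using that by (simp_all add: x definite_region_def)
    have "((1 - t) * r)\<^sup>2 \<le> r\<^sup>2" if "0 \<le> t" "t \<le> 1" for t
      using that by (simp add: power_mult_distrib mult_left_le_one_le power_le_one)
    then have "(p, (1 - t) * r) \<in> definite_region \<sigma>" if "0 \<le> t" "t \<le> 1" for t
      using that R by (force simp: definite_region_def)
    then show ?thesis by (auto simp: x closed_segment_def algebra_simps)
  qed
  show "closed_segment ((\<lambda>(p, r). (p, 0)) x) (1, 0) \<subseteq> definite_region \<sigma>" if "x \<in> definite_region \<sigma>" for x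
  proof -
    obtain p r where x: "x = (p, r)" by (cases x)
    have R: "0 \<le> p" "\<sigma> \<le> p" using that by (simp_all add: x definite_region_def)
    have "((1 - t) * p + t, 0) \<in> definite_region \<sigma>" if t: "0 \<le> t" "t \<le> 1" for t
    proof (rule axis)
      show "0 \<le> (1 - t) * p + t" using R t by simp
      have "(1 - t) * \<sigma> + t * \<sigma> \<le> (1 - t) * p + t * 1"
        using R t \<sigma> by (intro add_mono mult_left_mono) auto
      then show "\<sigma> \<le> (1 - t) * p + t" by (simp add: algebra_simps)
    qed
    then show ?thesis by (auto simp: x closed_segment_def algebra_simps)
  qed
qed

lemma indefinite_region_closed: "closed indefinite_region"
  unfolding indefinite_region_def case_prod_unfold by (intro closed_Collect_le continuous_intros)

lemma definite_region_closed: "closed (definite_region \<sigma>)"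
  unfolding definite_region_def case_prod_unfold
  by (intro closed_Collect_conj closed_Collect_le continuous_intros)

section \<open>From normal forms to the moduli space\<close>

text \<open>Every orbit contains a normal form, and \<open>Theta\<close> separates normal forms
  because \<open>Theta_of \<sigma>\<close> is injective. The image is therefore a homeomorphic copy
  of \<open>R\<close>.\<close>

lemma moduli_image_of_normal_forms:
  assumes \<sigma>: "\<sigma> * \<sigma> = 1"
    and N: "\<And>x. x \<in> R \<Longrightarrow> N x \<in> Z \<epsilon>" "\<And>x. x \<in> R \<Longrightarrow> Theta (N x) = Theta_of \<sigma> x"
    and red: "\<And>G. G \<in> Z \<epsilon> \<Longrightarrow> \<exists>x \<in> R. G \<simeq> N x"
    and R: "closed R" "contractible R"
  shows "inj_on Theta_moduli (moduli \<epsilon>) \<and> closed (Theta_moduli ` moduli \<epsilon>) \<and>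
    simply_connected (Theta_moduli ` moduli \<epsilon>)"
proof -
  obtain \<Phi> where \<Phi>: "continuous_on UNIV \<Phi>"
    "\<And>x. \<Phi> (Theta_of \<sigma> x) = x" "\<And>y. Theta_of \<sigma> (\<Phi> y) = y"
    using Theta_of_inverse[OF \<sigma>] by blast
  define cls where "cls = (\<lambda>x. gl_rel \<epsilon> `` {N x})"
  have Theta_cls: "Theta_moduli (cls x) = Theta_of \<sigma> x" if "x \<in> R" for x
    using that N Theta_moduli_class by (simp add: cls_def)
  have "moduli \<epsilon> = cls ` R"
  proof
    show "moduli \<epsilon> \<subseteq> cls ` R"
    proof
      fix X assume "X \<in> moduli \<epsilon>"
      then obtain G where G: "G \<in> Z \<epsilon>" "X = gl_rel \<epsilon> `` {G}"
        by (auto simp: moduli_def elim: quotientE)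
      obtain x where x: "x \<in> R" "G \<simeq> N x" using red[OF G(1)] by blast
      then have "(G, N x) \<in> gl_rel \<epsilon>" using G N by (auto simp: gl_rel_def isomorphic_def)
      then show "X \<in> cls ` R"
        using x(1) G(2) equiv_class_eq[OF equiv_gl_rel] by (auto simp: cls_def)
    qed
    show "cls ` R \<subseteq> moduli \<epsilon>" using N by (auto simp: cls_def moduli_def intro: quotientI)
  qed
  moreover have "inj_on Theta_moduli (cls ` R)"
    by (intro inj_onI) (metis (no_types, lifting) Theta_cls \<Phi>(2) imageE)
  moreover have image: "Theta_moduli ` cls ` R = Theta_of \<sigma> ` R"
    using Theta_cls by (simp add: image_image)
  \<comment> \<open>Closedness comes from writing the image as a preimage under the continuous
    inverse.\<close>
  moreover have "Theta_of \<sigma> ` R = \<Phi> -` R"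
    using \<Phi>(2,3) by (auto simp: image_iff) metis
  then have "closed (Theta_of \<sigma> ` R)"
    using closed_vimage[OF R(1) \<Phi>(1)] by simp
  moreover have "R homeomorphic (Theta_of \<sigma> ` R)"
  proof -
    have "continuous_on R (Theta_of \<sigma>)"
      unfolding Theta_of_def case_prod_unfold by (intro continuous_intros)
    then have "homeomorphism R (Theta_of \<sigma> ` R) (Theta_of \<sigma>) \<Phi>"
      using \<Phi> by (intro homeomorphismI) (auto intro: continuous_on_subset)
    then show ?thesis by (auto simp: homeomorphic_def)
  qed
  then have "simply_connected (Theta_of \<sigma> ` R)"
    using R(2) contractible_imp_simply_connected homeomorphic_simply_connected by blast
  ultimately show ?thesis by metis
qed

theorem theorem1p4:
  fixes \<epsilon> :: definiteness
  shows "inj_on Theta_moduli (moduli \<epsilon>) \<and>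
         closed (Theta_moduli ` moduli \<epsilon>) \<and>
         simply_connected (Theta_moduli ` moduli \<epsilon>)"
proof -
  have definite: ?thesis if "\<epsilon> = Positive \<and> \<sigma> = 1 \<or> \<epsilon> = Negative \<and> \<sigma> = - 1" for \<sigma> :: real
    by (rule moduli_image_of_normal_forms[of \<sigma> "definite_region \<sigma>" "definite_form \<sigma>"])
       (use that definite_form definite_reduction definite_region_closed
         definite_region_contractible in auto)
  show ?thesis
  proof (cases \<epsilon>)
    case Positive
    then show ?thesis using definite[of 1] by simp
  next
    case Negative
    then show ?thesis using definite[of "- 1"] by simp
  next
    case Indefinite
    show ?thesis unfolding Indefinite
      by (rule moduli_image_of_normal_forms[of 1 indefinite_region indefinite_form])
         (use indefinite_form indefinite_reduction indefinite_region_closed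
           indefinite_region_contractible in auto)
  qed
qed

end
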